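(* A graph is an expanded-clique graph if and only if it is (bad chain, butterfly, claw, $C_4$, diamond, odd-hole)-free.
   Context: All graphs are finite, simple and undirected. Let $G$ be a graph with vertex set $\{v_1,\dots,v_n\}$ and $f:V(G)\to\mathbb{N}$ a function with $f(v_i)\ge d_G(v_i)$ for every $i$. The expanded-clique graph $H$ of $(G,f)$ is the graph (unique up to isomorphism) defined as follows: $V(H)$ is the disjoint union of sets $V_1,\dots,V_n$, where $V_i$ has $f(v_i)$ vertices and forms a clique of $H$; for each edge $v_iv_j\in E(G)$ there are vertices $v_{i,j}\in V_i$ and $v_{j,i}\in V_j$ with $v_{i,j}v_{j,i}\in E(H)$, where the vertices $v_{i,j}$ (over all ordered pairs with $v_iv_j\in E(G)$) are pairwise distinct; and $H$ has no other edges. A graph is an expanded-clique graph if it is the expanded-clique graph of some pair $(G,f)$. For $k\ge 3$, a sequence of vertices $u_1,\dots,u_k$ of a graph $F$ is a chain if $u_iu_{i+1}\in E(F)$ for $i\in\{1,\dots,k-1\}$, $d(u_i)=2$ for $i\in\{2,\dots,k-1\}$, and it is maximal with these properties (degrees are taken in $F$). A chain is bad if $k$ is odd, $d(u_1)\ge 3$ and $d(u_k)\ge 3$. The claw is $K_{1,3}$; the diamond is an induced cycle $C_4$ plus one chord; an odd-hole is an induced cycle $C_q$ with $q$ an odd number greater than $4$; the butterfly is the graph on five vertices consisting of two triangles sharing exactly one vertex. Being free of all of these means having no bad chain and containing no butterfly, claw, $C_4$, diamond or odd-hole as an induced subgraph.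
   Formalization: A chain is required to be an induced path (distinct vertices, only consecutive ones adjacent); otherwise the bull, an expanded-clique graph, would have a bad chain through its degree-2 triangle vertex, so the claim would be false. *)

theory Defs
  imports "Graph_Theory.Graph_Theory" "HOL-Library.Disjoint_Sets"
begin

text \<open>
  A finite simple undirected graph is a symmetric loop-free digraph without parallel arcs
  (locale \<open>pair_graph\<close>): an undirected edge \<open>uv\<close> is the pair of arcs \<open>(u, v)\<close>, \<open>(v, u)\<close>.
  Since every edge at \<open>v\<close> gives exactly one arc leaving \<open>v\<close>, the degree is the out-degree.
\<close>

abbreviation deg :: "'a pair_pre_digraph \<Rightarrow> 'a \<Rightarrow> nat" where
  "deg G v \<equiv> out_degree (with_proj G) v"

subsection \<open>Expanded-clique graphs\<close>

text \<open>
  \<open>V i\<close> is the clique replacing the vertex \<open>i\<close> of \<open>G\<close>, and \<open>p i j\<close> is the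
  vertex of \<open>V i\<close> that carries the edge towards \<open>V j\<close>.  The definition describes \<open>H\<close> up to
  isomorphism, since \<open>V\<close> and \<open>p\<close> are arbitrary.
\<close>

definition expanded_clique_graph_of ::
  "'b pair_pre_digraph \<Rightarrow> ('b \<Rightarrow> nat) \<Rightarrow> 'a pair_pre_digraph \<Rightarrow> bool" where
  "expanded_clique_graph_of G f H \<longleftrightarrow>
     pair_graph G \<and> pair_graph H \<and> (\<forall>v \<in> pverts G. deg G v \<le> f v) \<and>
     (\<exists>V p.
        pverts H = (\<Union>i \<in> pverts G. V i) \<and>
        disjoint_family_on V (pverts G) \<and>
        (\<forall>i \<in> pverts G. card (V i) = f i) \<and>
        (\<forall>(i, j) \<in> parcs G. p i j \<in> V i) \<and>
        inj_on (\<lambda>(i, j). p i j) (parcs G) \<and>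
        parcs H = {(x, y). x \<noteq> y \<and> (\<exists>i \<in> pverts G. x \<in> V i \<and> y \<in> V i)}
                  \<union> {(p i j, p j i) | i j. (i, j) \<in> parcs G})"

text \<open>
  As \<open>G\<close> is finite, nothing is lost by taking its vertices to be natural numbers.
\<close>

definition expanded_clique_graph :: "'a pair_pre_digraph \<Rightarrow> bool" where
  "expanded_clique_graph H \<longleftrightarrow>
     (\<exists>(G :: nat pair_pre_digraph) f. expanded_clique_graph_of G f H)"

subsection \<open>Chains\<close>

text \<open>
  The list \<open>us\<close> is \<open>u\<^sub>1, \<dots>, u\<^sub>k\<close>, so the inner vertices are those
  at the (zero-based) positions \<open>1, \<dots>, k - 2\<close>.  A chain is understood as an induced path:
  its vertices are distinct and only consecutive ones are adjacent.  Without the latter, the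
  triangle of the bull (a triangle with pendant edges at two of its vertices), listed with its
  vertex of degree 2 in the middle, would be a bad chain, although the bull is the
  expanded-clique graph of a path on three vertices with \<open>f = (1, 3, 1)\<close>.
\<close>

definition prechain :: "'a pair_pre_digraph \<Rightarrow> 'a list \<Rightarrow> bool" where
  "prechain F us \<longleftrightarrow>
     3 \<le> length us \<and> vpath us (with_proj F) \<and>
     (\<forall>i j. i < j \<and> j < length us \<and> (us ! i, us ! j) \<in> parcs F \<longrightarrow> j = Suc i) \<and>
     (\<forall>i. 0 < i \<and> i < length us - 1 \<longrightarrow> deg F (us ! i) = 2)"

definition chain :: "'a pair_pre_digraph \<Rightarrow> 'a list \<Rightarrow> bool" where
  "chain F us \<longleftrightarrow>
     prechain F us \<and>
     (\<forall>xs ys. prechain F (xs @ us @ ys) \<longrightarrow> xs = [] \<and> ys = [])"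

definition bad_chain :: "'a pair_pre_digraph \<Rightarrow> 'a list \<Rightarrow> bool" where
  "bad_chain F us \<longleftrightarrow>
     chain F us \<and> odd (length us) \<and> 3 \<le> deg F (hd us) \<and> 3 \<le> deg F (last us)"

subsection \<open>Forbidden induced subgraphs\<close>

definition graph_of_edges :: "nat \<Rightarrow> (nat \<times> nat) set \<Rightarrow> nat pair_pre_digraph" where
  "graph_of_edges n E = \<lparr> pverts = {..<n}, parcs = E \<union> E\<inverse> \<rparr>"

text \<open>The cycle \<open>C\<^sub>q\<close>; only meaningful for \<open>q \<ge> 3\<close>.\<close>

definition cycle_graph :: "nat \<Rightarrow> nat pair_pre_digraph" where
  "cycle_graph q = graph_of_edges q {(i, Suc i mod q) | i. i < q}"

definition diamond_graph :: "nat pair_pre_digraph" where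
  "diamond_graph = graph_of_edges 4 {(0, 1), (1, 2), (2, 3), (3, 0), (0, 2)}"

definition butterfly_graph :: "nat pair_pre_digraph" where
  "butterfly_graph = graph_of_edges 5 {(0, 1), (1, 2), (2, 0), (0, 3), (3, 4), (4, 0)}"

definition contains_induced :: "'a pair_pre_digraph \<Rightarrow> 'b pair_pre_digraph \<Rightarrow> bool" where
  "contains_induced F P \<longleftrightarrow>
     (\<exists>H. induced_subgraph H (with_proj F) \<and> digraph_iso (with_proj P) H)"

definition contains_claw :: "'a pair_pre_digraph \<Rightarrow> bool" where
  "contains_claw F \<longleftrightarrow> (\<exists>H. induced_subgraph H (with_proj F) \<and> K\<^bsub>1,3\<^esub> H)"

definition contains_odd_hole :: "'a pair_pre_digraph \<Rightarrow> bool" where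
  "contains_odd_hole F \<longleftrightarrow> (\<exists>q. odd q \<and> 4 < q \<and> contains_induced F (cycle_graph q))"

end

theory Submission
  imports Defs
begin

text \<open>
  A graph is an expanded-clique graph iff its vertices can be partitioned into cliques such that
  every vertex has at most one neighbour outside its clique and any two cliques are joined by at
  most one edge. Along an induced path or a hole, edges inside a clique then alternate with edges
  between cliques, which excludes bad chains, odd holes and the small patterns.

  Conversely, claw-, diamond- and butterfly-freeness force the triangles to group into disjoint
  cliques each of whose vertices has at most one further edge, while a vertex outside all triangles
  has degree at most two. The edges in no triangle have to be 2-coloured (inner or crossing) so that
  the colours differ at each vertex in no triangle and edges meeting a triangle are crossing. An
  obstruction is a closed walk or a walk between triangles that would force an odd number of
  changes; a shortest one traces out an odd hole or a bad chain. The crossing edges between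
  two cliques are then unique because there is no induced \<open>C\<^sub>4\<close>.
\<close>

subsection \<open>Alternating colourings\<close>

text \<open>Elements of \<open>P\<close> are pinned to the colour True. Along an odd walk the colour
  would change an odd number of times, so the obstructions are the closed odd walks and the odd
  walks between two pinned elements. If there are none, parity of walks from a root colours each
  component; otherwise a shortest obstruction repeats nothing except possibly its two ends.\<close>

lemma alternating_coloring_or_odd_walk:
  fixes R :: "'e rel"
  assumes "sym R"
  obtains (coloring) c where "\<And>x y. (x, y) \<in> R \<Longrightarrow> c x \<noteq> c y" and "\<And>x. x \<in> P \<Longrightarrow> c x"
  | (odd_walk) n e where "odd n" and "\<And>i. i < n \<Longrightarrow> (e i, e (Suc i)) \<in> R"
      and "\<And>i j. \<lbrakk>i < j; j \<le> n; e i = e j\<rbrakk> \<Longrightarrow> i = 0 \<and> j = n"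
      and "e 0 = e n \<or> e 0 \<in> P \<and> e n \<in> P"
proof -
  define Q where "Q n e \<longleftrightarrow> odd n \<and> (\<forall>i<n. (e i, e (Suc i)) \<in> R)
    \<and> (e 0 = e n \<or> e 0 \<in> P \<and> e n \<in> P)" for n and e :: "nat \<Rightarrow> 'e"
  show thesis
  proof (cases "\<exists>n e. Q n e")
    case True
    define n where "n = (LEAST n. \<exists>e. Q n e)"
    have "\<exists>e. Q n e" unfolding n_def using True by (rule LeastI_ex)
    then obtain e where e: "Q n e" ..
    have least: "\<not> Q m f" if "m < n" for m f
      using not_less_Least[of m "\<lambda>n. \<exists>e. Q n e"] that unfolding n_def by blast
    show thesis
    proof (rule odd_walk[of n e])
      fix i j assume ij: "i < j" "j \<le> n" "e i = e j"
      show "i = 0 \<and> j = n"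
      proof (rule ccontr)
        assume neg: "\<not> (i = 0 \<and> j = n)"
        then have "j - i < n" using ij by auto
        show False
        proof (cases "odd (j - i)")
          case True
          \<comment> \<open>The segment between the two equal entries is a shorter closed odd
            walk.\<close>
          then have "Q (j - i) (\<lambda>k. e (i + k))" using e ij unfolding Q_def by auto
          with least \<open>j - i < n\<close> show False by blast
        next
          case False
          \<comment> \<open>Cutting out a closed segment of even length keeps the parity and both
            end entries.\<close>
          define f where "f k = (if k \<le> i then e k else e (k + (j - i)))" for k
          have step: "(f k, f (Suc k)) \<in> R" if "k < n - (j - i)" for k
          proof -
            consider "k < i" | "k = i" | "k > i" by linarith
            then show ?thesis
            proof cases
              case 2
              then have "f k = e j" "f (Suc k) = e (Suc j)" using ij by (auto simp: f_def)
              then show ?thesis using e that 2 ij unfolding Q_def by simp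
            qed (use e that ij in \<open>auto simp: f_def Q_def\<close>)
          qed
          have "f (n - (j - i)) = e n" using ij by (cases "j = n") (auto simp: f_def)
          moreover have "f 0 = e 0" by (simp add: f_def)
          ultimately have "Q (n - (j - i)) f"
            using e step False ij unfolding Q_def by auto
          moreover have "n - (j - i) < n" using ij by auto
          ultimately show False using least by blast
        qed
      qed
    next
      show "odd n" "e 0 = e n \<or> e 0 \<in> P \<and> e n \<in> P" using e unfolding Q_def by blast+
    next
      show "(e i, e (Suc i)) \<in> R" if "i < n" for i using e that unfolding Q_def by blast
    qed
  next
    case False
    have no_odd: "False" if "(x, y) \<in> R ^^ n" "odd n" "x = y \<or> x \<in> P \<and> y \<in> P" for x y n
      proof -
      from that(1) obtain e where e: "e 0 = x" "e n = y" "\<forall>i<n. (e i, e (Suc i)) \<in> R"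
        unfolding relpow_fun_conv by blast
      then have "Q n e" using that(2,3) by (simp add: Q_def)
      with False show False by blast
    qed
    \<comment> \<open>The root depends only on the component of \<open>x\<close>, so adjacent
      elements share it, and it is pinned whenever the component meets \<open>P\<close>.\<close>
    define root where "root x = (let C = R\<^sup>* `` {x} in
      if C \<inter> P = {} then SOME y. y \<in> C else SOME y. y \<in> C \<inter> P)" for x
    define c where "c x \<longleftrightarrow> (\<exists>n. even n \<and> (root x, x) \<in> R ^^ n)" for x
    have symR: "(y, x) \<in> R\<^sup>*" if "(x, y) \<in> R\<^sup>*" for x y
      using sym_rtrancl[OF \<open>sym R\<close>] that by (auto dest: symD)
    have root: "(x, root x) \<in> R\<^sup>*" for x
    proof (cases "R\<^sup>* `` {x} \<inter> P = {}")
      case True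
      then have "root x = (SOME y. y \<in> R\<^sup>* `` {x})" by (simp add: root_def Let_def)
      then show ?thesis by (metis Image_singleton_iff rtrancl.rtrancl_refl someI_ex)
    next
      case False
      then have "root x = (SOME y. y \<in> R\<^sup>* `` {x} \<inter> P)" by (simp add: root_def Let_def)
      then have "root x \<in> R\<^sup>* `` {x} \<inter> P" using False some_in_eq by metis
      then show ?thesis by simp
    qed
    then have "\<forall>x. \<exists>n. (root x, x) \<in> R ^^ n" using symR rtrancl_imp_relpow by blast
    then obtain dist where dist: "(root x, x) \<in> R ^^ dist x" for x by metis
    have flip: "c x \<noteq> c y" if xy: "(x, y) \<in> R" for x y
    proof -
      have "R\<^sup>* `` {x} = R\<^sup>* `` {y}"
        using xy symD[OF \<open>sym R\<close> xy] by (auto intro: converse_rtrancl_into_rtrancl)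
      then have eq: "root x = root y" by (simp add: root_def)
      have ext: "(root y, y) \<in> R ^^ Suc n" if "(root x, x) \<in> R ^^ n" for n
        using that xy eq by auto
      show ?thesis
      proof (cases "c x")
        case True
        then obtain m where m: "even m" "(root x, x) \<in> R ^^ m" by (auto simp: c_def)
        have "\<not> c y"
        proof
          assume "c y"
          then obtain k where k: "even k" "(root y, y) \<in> R ^^ k" by (auto simp: c_def)
          have rev: "(v, u) \<in> R ^^ l" if "(u, v) \<in> R ^^ l" for u v l
            using that
          proof (induction l arbitrary: v)
            case (Suc l)
            then show ?case using relpow_Suc_I2[OF symD[OF \<open>sym R\<close>]] by (metis relpow_Suc_E)
          qed simp
          \<comment> \<open>Even walks from the root to both ends of an edge, joined by that edge,
            close up to an odd walk at the root.\<close>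
          have "(root y, root y) \<in> R ^^ (k + Suc m)"
            using k rev[OF ext[OF m(2)]] unfolding relpow_add by blast
          moreover have "odd (k + Suc m)" using m k by simp
          ultimately show False using no_odd by blast
        qed
        then show ?thesis using True by simp
      next
        case False
        then have "odd (dist x)" using dist by (auto simp: c_def)
        then have "even (Suc (dist x))" by simp
        then have "c y" using ext[OF dist] unfolding c_def by blast
        then show ?thesis using False by simp
      qed
    qed
    moreover have "c x" if "x \<in> P" for x
    proof -
      have "x \<in> R\<^sup>* `` {x} \<inter> P" using that by simp
      then have "root x \<in> R\<^sup>* `` {x} \<inter> P"
        unfolding root_def Let_def by (metis (lifting) empty_iff someI_ex)
      \<comment> \<open>Both \<open>x\<close> and its root are pinned, so no odd walk joins
        them.\<close>
      then have "even (dist x)" using no_odd dist that by blast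
      then show ?thesis using dist by (auto simp: c_def)
    qed
    ultimately show thesis by (rule coloring)
  qed
qed

subsection \<open>The forbidden induced subgraphs\<close>

text \<open>Replaces an isomorphism onto an induced subgraph, which acts on vertices and on arcs
  separately, by a vertex map that preserves and reflects adjacency.\<close>

lemma contains_induced_iff:
  assumes "pair_graph F" and P: "parcs P \<subseteq> pverts P \<times> pverts P"
  shows "contains_induced F P \<longleftrightarrow> (\<exists>g. inj_on g (pverts P) \<and> g ` pverts P \<subseteq> pverts F \<and>
    (\<forall>u\<in>pverts P. \<forall>v\<in>pverts P. (u, v) \<in> parcs P \<longleftrightarrow> (g u, g v) \<in> parcs F))" (is "_ \<longleftrightarrow> ?R")
proof
  interpret pair_graph F by fact
  assume "contains_induced F P"
  then obtain h where ind: "induced_subgraph (app_iso h (with_proj P)) (with_proj F)"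
    and iso: "pre_digraph.digraph_isomorphism (with_proj P) h"
    unfolding contains_induced_def digraph_iso_def by blast
  interpret P: pre_digraph "with_proj P" .
  define g where "g = iso_verts h"
  \<comment> \<open>A subgraph of \<open>F\<close> inherits the projections as tail and head, so the
    image of an arc is determined by the images of its ends.\<close>
  have comp: "iso_tail h = fst" "iso_head h = snd"
    using ind unfolding induced_subgraph_def subgraph_def compatible_def by auto
  have arc: "iso_arcs h (u, v) = (g u, g v)" if "(u, v) \<in> parcs P" for u v
    using iso that comp unfolding P.digraph_isomorphism_def g_def by (auto simp: prod_eq_iff)
  have arcs: "iso_arcs h ` parcs P = {e \<in> parcs F. fst e \<in> g ` pverts P \<and> snd e \<in> g ` pverts P}"
    using ind unfolding induced_subgraph_def g_def by auto
  have inj: "inj_on g (pverts P)" using iso unfolding P.digraph_isomorphism_def g_def by simp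
  have "g ` pverts P \<subseteq> pverts F"
    using ind unfolding induced_subgraph_def subgraph_def g_def by auto
  moreover have "(u, v) \<in> parcs P \<longleftrightarrow> (g u, g v) \<in> parcs F"
    if uv: "u \<in> pverts P" "v \<in> pverts P" for u v
  proof
    assume "(u, v) \<in> parcs P"
    then have "(g u, g v) \<in> iso_arcs h ` parcs P" by (metis arc image_eqI)
    then show "(g u, g v) \<in> parcs F" unfolding arcs by simp
  next
    assume "(g u, g v) \<in> parcs F"
    then have "(g u, g v) \<in> iso_arcs h ` parcs P" unfolding arcs using uv by simp
    then obtain u' v' where uv': "(u', v') \<in> parcs P" "g u' = g u" "g v' = g v"
      using arc by fastforce
    then have "u' = u" "v' = v" using uv P inj by (auto dest: inj_onD)
    with uv' show "(u, v) \<in> parcs P" by simp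
  qed
  ultimately show ?R using inj by blast
next
  interpret pair_graph F by fact
  assume ?R
  then obtain g where inj: "inj_on g (pverts P)" and sub: "g ` pverts P \<subseteq> pverts F"
    and arcs: "\<And>u v. u \<in> pverts P \<Longrightarrow> v \<in> pverts P \<Longrightarrow> (u, v) \<in> parcs P \<longleftrightarrow> (g u, g v) \<in> parcs F"
    by blast
  define h where "h = \<lparr>iso_verts = g, iso_arcs = map_prod g g, iso_head = snd, iso_tail = fst\<rparr>"
  define H where "H = app_iso h (with_proj P)"
  interpret P: pre_digraph "with_proj P" .
  have "inj_on (map_prod g g) (parcs P)"
    by (rule inj_on_subset[OF map_prod_inj_on[OF inj inj] P])
  moreover have "wf_digraph (with_proj P)" using P by unfold_locales auto
  ultimately have "P.digraph_isomorphism h"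
    using inj unfolding P.digraph_isomorphism_def h_def by auto
  moreover have "induced_subgraph H (with_proj F)"
  proof
    have "wf_digraph H" unfolding H_def app_iso_def h_def using P by unfold_locales auto
    moreover have "parcs F \<supseteq> map_prod g g ` parcs P" using arcs P by auto
    moreover have "wf_digraph (with_proj F)" using wf_digraph_axioms by simp
    ultimately show "subgraph H (with_proj F)" using sub
      unfolding subgraph_def compatible_def H_def app_iso_def h_def by auto
    have "map_prod g g ` parcs P = {e \<in> parcs F. fst e \<in> g ` pverts P \<and> snd e \<in> g ` pverts P}"
    proof (intro set_eqI iffI)
      fix e assume "e \<in> map_prod g g ` parcs P"
      then obtain u v where "e = (g u, g v)" "(u, v) \<in> parcs P" by auto
      then show "e \<in> {e \<in> parcs F. fst e \<in> g ` pverts P \<and> snd e \<in> g ` pverts P}"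
        using arcs P by auto
    next
      fix e assume "e \<in> {e \<in> parcs F. fst e \<in> g ` pverts P \<and> snd e \<in> g ` pverts P}"
      then obtain u v where "e = (g u, g v)" "u \<in> pverts P" "v \<in> pverts P" "e \<in> parcs F"
        by (cases e) auto
      then show "e \<in> map_prod g g ` parcs P" using arcs by (auto intro!: rev_image_eqI)
    qed
    then show "arcs H = {e \<in> arcs (with_proj F). tail (with_proj F) e \<in> verts H \<and>
        head (with_proj F) e \<in> verts H}"
      unfolding H_def app_iso_def h_def by simp
  qed
  ultimately show "contains_induced F P"
    unfolding contains_induced_def digraph_iso_def H_def by blast
qed

lemma contains_induced_graph_of_edges_iff:
  assumes "pair_graph F" and "E \<subseteq> {..<n} \<times> {..<n}"
  shows "contains_induced F (graph_of_edges n E) \<longleftrightarrow>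
    (\<exists>g. inj_on g {..<n} \<and> g ` {..<n} \<subseteq> pverts F \<and>
      (\<forall>i<n. \<forall>j<n. (i, j) \<in> E \<or> (j, i) \<in> E \<longleftrightarrow> (g i, g j) \<in> parcs F))"
proof -
  have P: "parcs (graph_of_edges n E) \<subseteq> pverts (graph_of_edges n E) \<times> pverts (graph_of_edges n E)"
    using assms(2) by (auto simp: graph_of_edges_def)
  show ?thesis
    unfolding contains_induced_iff[OF assms(1) P] by (simp add: graph_of_edges_def Ball_def)
qed

text \<open>With the embedding given as a list, a pattern on four or five vertices turns into a
  statement about explicitly named vertices.\<close>

lemma contains_induced_graph_of_edges_iff_list:
  assumes "pair_graph F" and "E \<subseteq> {..<n} \<times> {..<n}"
  shows "contains_induced F (graph_of_edges n E) \<longleftrightarrow>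
    (\<exists>xs. length xs = n \<and> distinct xs \<and> set xs \<subseteq> pverts F \<and>
      (\<forall>i<n. \<forall>j<n. (i, j) \<in> E \<or> (j, i) \<in> E \<longleftrightarrow> (xs ! i, xs ! j) \<in> parcs F))"
    (is "_ \<longleftrightarrow> (\<exists>xs. ?R xs)")
  unfolding contains_induced_graph_of_edges_iff[OF assms]
proof
  assume "\<exists>g. inj_on g {..<n} \<and> g ` {..<n} \<subseteq> pverts F \<and>
      (\<forall>i<n. \<forall>j<n. (i, j) \<in> E \<or> (j, i) \<in> E \<longleftrightarrow> (g i, g j) \<in> parcs F)"
  then obtain g where g: "inj_on g {..<n}" "g ` {..<n} \<subseteq> pverts F"
    "\<forall>i<n. \<forall>j<n. (i, j) \<in> E \<or> (j, i) \<in> E \<longleftrightarrow> (g i, g j) \<in> parcs F" by blast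
  have "distinct (map g [0..<n])" using g(1) by (simp add: distinct_map lessThan_atLeast0)
  moreover have "set (map g [0..<n]) \<subseteq> pverts F" using g(2) by (simp add: lessThan_atLeast0)
  ultimately have "?R (map g [0..<n])" using g(3) by simp
  then show "\<exists>xs. ?R xs" ..
next
  assume "\<exists>xs. ?R xs"
  then obtain xs where xs: "?R xs" ..
  then have "inj_on ((!) xs) {..<n} \<and> (!) xs ` {..<n} \<subseteq> pverts F"
    by (auto intro: inj_on_nth)
  with xs show "\<exists>g. inj_on g {..<n} \<and> g ` {..<n} \<subseteq> pverts F \<and>
      (\<forall>i<n. \<forall>j<n. (i, j) \<in> E \<or> (j, i) \<in> E \<longleftrightarrow> (g i, g j) \<in> parcs F)"
    by (intro exI[of _ "(!) xs"]) blast
qed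

lemma contains_cycle_iff:
  assumes "pair_graph F"
  shows "contains_induced F (cycle_graph q) \<longleftrightarrow>
    (\<exists>g. inj_on g {..<q} \<and> g ` {..<q} \<subseteq> pverts F \<and>
      (\<forall>i<q. \<forall>j<q. j = Suc i mod q \<or> i = Suc j mod q \<longleftrightarrow> (g i, g j) \<in> parcs F))"
  unfolding cycle_graph_def
proof (subst contains_induced_graph_of_edges_iff[OF assms])
  show "{(i, Suc i mod q) |i. i < q} \<subseteq> {..<q} \<times> {..<q}" by auto
qed (simp add: disj_commute)

lemma (in pair_graph) parcs_sym: "(x, y) \<in> parcs G \<longleftrightarrow> (y, x) \<in> parcs G"
  using pair_sym_arcs by (auto simp: symmetric_def dest: symD)

lemma (in pair_graph) parcs_irrefl: "(x, x) \<notin> parcs G"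
  using pair_no_loops by fastforce

lemma contains_claw_iff:
  assumes "pair_graph F"
  shows "contains_claw F \<longleftrightarrow> (\<exists>v a b c. (v, a) \<in> parcs F \<and> (v, b) \<in> parcs F \<and> (v, c) \<in> parcs F \<and>
    a \<noteq> b \<and> a \<noteq> c \<and> b \<noteq> c \<and> (a, b) \<notin> parcs F \<and> (a, c) \<notin> parcs F \<and> (b, c) \<notin> parcs F)" (is "_ \<longleftrightarrow> ?R")
proof
  interpret pair_graph F by fact
  assume "contains_claw F"
  then obtain H where ind: "induced_subgraph H (with_proj F)" and "K\<^bsub>1,3\<^esub> H"
    unfolding contains_claw_def by blast
  then obtain U W where UW: "verts H = U \<union> W" "U \<inter> W = {}" "card U = 1" "card W = 3"
    "arcs_ends H = U \<times> W \<union> W \<times> U" unfolding complete_bipartite_digraph_def by blast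
  obtain v where v: "U = {v}" using UW(3) card_1_singletonE by blast
  obtain a b c where abc: "W = {a, b, c}" "a \<noteq> b" "a \<noteq> c" "b \<noteq> c"
    using UW(4) by (auto simp: card_Suc_eq numeral_3_eq_3)
  have "tail H = fst" "head H = snd" "arcs H = {e \<in> parcs F. fst e \<in> verts H \<and> snd e \<in> verts H}"
    using ind unfolding induced_subgraph_def subgraph_def compatible_def by auto
  then have arcs: "{e \<in> parcs F. fst e \<in> verts H \<and> snd e \<in> verts H} = U \<times> W \<union> W \<times> U"
    using UW(5) by (simp add: arcs_ends_conv)
  have iff: "(x, y) \<in> parcs F \<longleftrightarrow> (x, y) \<in> U \<times> W \<union> W \<times> U" if "x \<in> verts H" "y \<in> verts H" for x y
    using that unfolding arcs[symmetric] by simp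
  have nv: "a \<noteq> v" "b \<noteq> v" "c \<noteq> v" using UW(2) abc v by auto
  have verts: "v \<in> verts H" "a \<in> verts H" "b \<in> verts H" "c \<in> verts H"
    unfolding UW(1) v abc(1) by simp_all
  have "(v, a) \<in> parcs F \<and> (v, b) \<in> parcs F \<and> (v, c) \<in> parcs F \<and>
    (a, b) \<notin> parcs F \<and> (a, c) \<notin> parcs F \<and> (b, c) \<notin> parcs F"
    unfolding iff[OF verts(1,2)] iff[OF verts(1,3)] iff[OF verts(1,4)]
      iff[OF verts(2,3)] iff[OF verts(2,4)] iff[OF verts(3,4)] v abc(1)
    using nv by simp
  with abc(2-) show ?R by blast
next
  interpret pair_graph F by fact
  assume ?R
  then obtain v a b c where
    arcs: "(v, a) \<in> parcs F" "(v, b) \<in> parcs F" "(v, c) \<in> parcs F" and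
    ne: "a \<noteq> b" "a \<noteq> c" "b \<noteq> c" and
    nadj: "(a, b) \<notin> parcs F" "(a, c) \<notin> parcs F" "(b, c) \<notin> parcs F" by blast
  define H where "H = \<lparr>pverts = {v, a, b, c}, parcs = {v} \<times> {a, b, c} \<union> {a, b, c} \<times> {v}\<rparr>"
  have ne': "v \<noteq> a" "v \<noteq> b" "v \<noteq> c" using arcs parcs_irrefl by auto
  have verts: "{v, a, b, c} \<subseteq> pverts F" using arcs wellformed' by blast
  have arcs': "(a, v) \<in> parcs F" "(b, v) \<in> parcs F" "(c, v) \<in> parcs F"
    and nadj': "(b, a) \<notin> parcs F" "(c, a) \<notin> parcs F" "(c, b) \<notin> parcs F"
    using arcs nadj parcs_sym by blast+
  have "K\<^bsub>1,3\<^esub> (with_proj H)"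
    unfolding complete_bipartite_digraph_pair_def
  proof (intro conjI)
    show "\<exists>U W. pverts H = U \<union> W \<and> U \<inter> W = {} \<and> card U = 1 \<and> card W = 3 \<and>
        parcs H = U \<times> W \<union> W \<times> U"
      unfolding H_def using ne ne'
      by (rule_tac x = "{v}" in exI, rule_tac x = "{a, b, c}" in exI) (simp add: insert_commute)
  qed (simp add: H_def)
  moreover have "induced_subgraph (with_proj H) (with_proj F)"
  proof
    have "wf_digraph (with_proj H)" by unfold_locales (auto simp: H_def)
    moreover have "wf_digraph (with_proj F)" using wf_digraph_axioms by simp
    ultimately show "subgraph (with_proj H) (with_proj F)"
      unfolding subgraph_def using arcs arcs' verts by (auto simp: H_def)
    show "arcs (with_proj H) = {e \<in> arcs (with_proj F).
        tail (with_proj F) e \<in> verts (with_proj H) \<and> head (with_proj F) e \<in> verts (with_proj H)}"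
    proof -
      have "{v} \<times> {a, b, c} \<union> {a, b, c} \<times> {v} =
          {e \<in> parcs F. fst e \<in> {v, a, b, c} \<and> snd e \<in> {v, a, b, c}}"
        (is "?L = ?R")
      proof (intro set_eqI iffI)
        show "e \<in> ?R" if "e \<in> ?L" for e using that arcs arcs' by auto
      next
        fix e assume "e \<in> ?R"
        then obtain x y where e: "e = (x, y)" "(x, y) \<in> parcs F"
          "x \<in> {v, a, b, c}" "y \<in> {v, a, b, c}" by (cases e) auto
        \<comment> \<open>An arc inside the four-element set has exactly one end at the centre:
          loops are excluded and the leaves are pairwise non-adjacent.\<close>
        have "x = v \<longleftrightarrow> y \<noteq> v"
          using e(3,4,2)
          by (elim insertE emptyE) (simp_all add: nadj nadj' parcs_irrefl ne'[symmetric])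
        then show "e \<in> ?L" using e by blast
      qed
      then show ?thesis by (simp add: H_def)
    qed
  qed
  ultimately show "contains_claw F" unfolding contains_claw_def by blast
qed

lemma ex_length_4: "(\<exists>xs. length xs = 4 \<and> R xs) \<longleftrightarrow> (\<exists>a b c d. R [a, b, c, d])" (is "_ \<longleftrightarrow> ?r")
proof
  assume "\<exists>xs. length xs = 4 \<and> R xs"
  then show ?r by (auto simp: numeral_eq_Suc length_Suc_conv)
next
  assume ?r
  then obtain a b c d where "R [a, b, c, d]" by blast
  then show "\<exists>xs. length xs = 4 \<and> R xs" by (intro exI[of _ "[a, b, c, d]"]) simp
qed

lemma ex_length_5: "(\<exists>xs. length xs = 5 \<and> R xs) \<longleftrightarrow> (\<exists>a b c d e. R [a, b, c, d, e])" (is "_ \<longleftrightarrow> ?r")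
proof
  assume "\<exists>xs. length xs = 5 \<and> R xs"
  then obtain xs where "length xs = 5" "R xs" by blast
  moreover from this obtain a b c d e where "xs = [a, b, c, d, e]"
    by (auto simp: numeral_eq_Suc length_Suc_conv)
  ultimately show ?r by blast
next
  assume ?r
  then obtain a b c d e where "R [a, b, c, d, e]" by blast
  then show "\<exists>xs. length xs = 5 \<and> R xs" by (intro exI[of _ "[a, b, c, d, e]"]) simp
qed

lemma all_less_4: "(\<forall>i<4. R i) \<longleftrightarrow> R 0 \<and> R 1 \<and> R 2 \<and> R (3::nat)"
  by (simp add: numeral_eq_Suc All_less_Suc2)

lemma all_less_5: "(\<forall>i<5. R i) \<longleftrightarrow> R 0 \<and> R 1 \<and> R 2 \<and> R 3 \<and> R (4::nat)"
  by (simp add: numeral_eq_Suc All_less_Suc2)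

text \<open>Reversed arcs, membership in \<open>pverts F\<close> and distinctness of adjacent
  vertices come from simplicity of the graph, so only the non-adjacent pairs need an explicit
  inequality. The diamond and the butterfly are treated in the same way.\<close>

lemma contains_C4_iff:
  assumes "pair_graph F"
  shows "contains_induced F (cycle_graph 4) \<longleftrightarrow> (\<exists>a b c d. a \<noteq> c \<and> b \<noteq> d \<and>
    (a, b) \<in> parcs F \<and> (b, c) \<in> parcs F \<and> (c, d) \<in> parcs F \<and> (d, a) \<in> parcs F \<and>
    (a, c) \<notin> parcs F \<and> (b, d) \<notin> parcs F)"
proof -
  interpret pair_graph F by fact
  have "{..<4} = {0, 1, 2, 3::nat}" by auto
  moreover have "{(i, Suc i mod 4) |i. i < 4} = (\<lambda>i. (i, (i + 1) mod 4)) ` {..<4}" by auto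
  ultimately have "{(i, Suc i mod 4) |i. i < 4} = {(0, 1), (1, 2), (2, 3), (3, 0)}"
    by (simp del: One_nat_def add_Suc_right add: one_add_one)
  then have C4: "cycle_graph 4 = graph_of_edges 4 {(0, 1), (1, 2), (2, 3), (3, 0)}"
    unfolding cycle_graph_def by (rule arg_cong)
  have E: "{(0, 1), (1, 2), (2, 3), (3, 0)} \<subseteq> {..<4::nat} \<times> {..<4::nat}" by auto
  show ?thesis
    unfolding C4 contains_induced_graph_of_edges_iff_list[OF assms E] ex_length_4 all_less_4
  proof (intro iff_exI iffI, goal_cases)
    case (1 a b c d)
    then show ?case by simp
  next
    case (2 a b c d)
    have
      "(b, a) \<in> parcs F" "(c, b) \<in> parcs F" "(d, c) \<in> parcs F" "(a, d) \<in> parcs F"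
      "(c, a) \<notin> parcs F" "(d, b) \<notin> parcs F"
      using 2 by (simp_all add: parcs_sym)
    moreover have
      "a \<noteq> b" "b \<noteq> c" "c \<noteq> d" "d \<noteq> a"
      using 2 by (auto simp: parcs_irrefl)
    moreover have "{a, b, c, d} \<subseteq> pverts F" using 2 by (auto dest: in_arcsD1)
    ultimately show ?case using 2 by (simp add: parcs_irrefl)
  qed
qed

lemma contains_diamond_iff:
  assumes "pair_graph F"
  shows "contains_induced F diamond_graph \<longleftrightarrow> (\<exists>a b c d. b \<noteq> d \<and>
    (a, b) \<in> parcs F \<and> (b, c) \<in> parcs F \<and> (c, d) \<in> parcs F \<and> (d, a) \<in> parcs F \<and>
    (a, c) \<in> parcs F \<and> (b, d) \<notin> parcs F)"
proof -
  interpret pair_graph F by fact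
  have E: "{(0, 1), (1, 2), (2, 3), (3, 0), (0, 2)} \<subseteq> {..<4::nat} \<times> {..<4::nat}" by auto
  show ?thesis
    unfolding diamond_graph_def contains_induced_graph_of_edges_iff_list[OF assms E]
      ex_length_4 all_less_4
  proof (intro iff_exI iffI, goal_cases)
    case (1 a b c d)
    then show ?case by simp
  next
    case (2 a b c d)
    have
      "(b, a) \<in> parcs F" "(c, b) \<in> parcs F" "(d, c) \<in> parcs F" "(a, d) \<in> parcs F"
      "(c, a) \<in> parcs F" "(d, b) \<notin> parcs F"
      using 2 by (simp_all add: parcs_sym)
    moreover have
      "a \<noteq> b" "b \<noteq> c" "c \<noteq> d" "d \<noteq> a" "a \<noteq> c"
      using 2 by (auto simp: parcs_irrefl)
    moreover have "{a, b, c, d} \<subseteq> pverts F" using 2 by (auto dest: in_arcsD1)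
    ultimately show ?case using 2 by (simp add: parcs_irrefl)
  qed
qed

lemma contains_butterfly_iff:
  assumes "pair_graph F"
  shows "contains_induced F butterfly_graph \<longleftrightarrow> (\<exists>v a b c d.
    (v, a) \<in> parcs F \<and> (a, b) \<in> parcs F \<and> (b, v) \<in> parcs F \<and>
    (v, c) \<in> parcs F \<and> (c, d) \<in> parcs F \<and> (d, v) \<in> parcs F \<and> a \<noteq> c \<and> a \<noteq> d \<and> b \<noteq> c \<and> b \<noteq> d \<and>
    (a, c) \<notin> parcs F \<and> (a, d) \<notin> parcs F \<and> (b, c) \<notin> parcs F \<and> (b, d) \<notin> parcs F)"
proof -
  interpret pair_graph F by fact
  have E: "{(0, 1), (1, 2), (2, 0), (0, 3), (3, 4), (4, 0)} \<subseteq> {..<5::nat} \<times> {..<5::nat}" by auto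
  show ?thesis
    unfolding butterfly_graph_def contains_induced_graph_of_edges_iff_list[OF assms E]
      ex_length_5 all_less_5
  proof (intro iff_exI iffI, goal_cases)
    case (1 v a b c d)
    then show ?case by simp
  next
    case (2 v a b c d)
    have
      "(a, v) \<in> parcs F" "(b, a) \<in> parcs F" "(v, b) \<in> parcs F" "(c, v) \<in> parcs F"
      "(d, c) \<in> parcs F" "(v, d) \<in> parcs F" "(c, a) \<notin> parcs F"
      "(d, a) \<notin> parcs F" "(c, b) \<notin> parcs F" "(d, b) \<notin> parcs F"
      using 2 by (simp_all add: parcs_sym)
    moreover have
      "v \<noteq> a" "a \<noteq> b" "b \<noteq> v" "v \<noteq> c" "c \<noteq> d" "d \<noteq> v"
      using 2 by (auto simp: parcs_irrefl)
    moreover have "{v, a, b, c, d} \<subseteq> pverts F" using 2 by (auto dest: in_arcsD1)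
    ultimately show ?case using 2 by (simp add: parcs_irrefl)
  qed
qed

subsection \<open>Clique partitions\<close>

text \<open>An intrinsic form of being an expanded-clique graph, with \<open>k x\<close> naming the
  clique of \<open>x\<close>; the base graph is recovered by contracting the classes. Arcs inside a
  class are called inner, the others crossing. In the last clause the other ends agree as well, by
  the second clause.\<close>

definition clique_partition :: "'a pair_pre_digraph \<Rightarrow> ('a \<Rightarrow> nat) \<Rightarrow> bool" where
  "clique_partition F k \<longleftrightarrow>
    (\<forall>x\<in>pverts F. \<forall>y\<in>pverts F. k x = k y \<longrightarrow> x \<noteq> y \<longrightarrow> (x, y) \<in> parcs F) \<and>
    (\<forall>x y z. (x, y) \<in> parcs F \<longrightarrow> (x, z) \<in> parcs F \<longrightarrow> k x \<noteq> k y \<longrightarrow> k x \<noteq> k z \<longrightarrow> y = z) \<and>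
    (\<forall>x y x' y'. (x, y) \<in> parcs F \<longrightarrow> (x', y') \<in> parcs F \<longrightarrow> k x = k x' \<longrightarrow> k y = k y' \<longrightarrow>
      k x \<noteq> k y \<longrightarrow> x = x')"

text \<open>Label a vertex by the index of the clique containing it. A crossing arc is then
  determined by the labels of its ends, and injectivity of \<open>p\<close> prevents two crossing
  arcs at one vertex.\<close>

lemma expanded_clique_graph_imp_clique_partition:
  assumes "expanded_clique_graph F"
  obtains k where "clique_partition F k"
proof -
  obtain G :: "nat pair_pre_digraph" and f where "expanded_clique_graph_of G f F"
    using assms unfolding expanded_clique_graph_def by blast
  then obtain V p where G: "pair_graph G" and verts: "pverts F = (\<Union>i \<in> pverts G. V i)"
    and disj: "disjoint_family_on V (pverts G)"
    and pV: "\<forall>(i, j) \<in> parcs G. p i j \<in> V i"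
    and inj: "inj_on (\<lambda>(i, j). p i j) (parcs G)"
    and arcs: "parcs F = {(x, y). x \<noteq> y \<and> (\<exists>i \<in> pverts G. x \<in> V i \<and> y \<in> V i)}
      \<union> {(p i j, p j i) | i j. (i, j) \<in> parcs G}"
    unfolding expanded_clique_graph_of_def by iprover
  interpret G: pair_graph G by fact
  have p: "p i j \<in> V i" if "(i, j) \<in> parcs G" for i j using pV that by blast
  define k where "k x = (SOME i. i \<in> pverts G \<and> x \<in> V i)" for x
  have k: "k x = i" if "i \<in> pverts G" "x \<in> V i" for x i
  proof -
    have "k x \<in> pverts G \<and> x \<in> V (k x)" unfolding k_def by (rule someI[of _ i]) (use that in simp)
    then show ?thesis using that disj by (auto simp: disjoint_family_on_def)
  qed
  define I where "I = {(x, y). x \<noteq> y \<and> (\<exists>i \<in> pverts G. x \<in> V i \<and> y \<in> V i)}"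
  define C where "C = {(p i j, p j i) | i j. (i, j) \<in> parcs G}"
  have arcs': "parcs F = I \<union> C" unfolding arcs I_def C_def ..
  have cross: "(k x, k y) \<in> parcs G \<and> x = p (k x) (k y) \<and> y = p (k y) (k x)"
    if "(x, y) \<in> parcs F" "k x \<noteq> k y" for x y
  proof -
    have "\<not> (\<exists>i \<in> pverts G. x \<in> V i \<and> y \<in> V i)" using that(2) k by metis
    \<comment> \<open>Different labels rule out an arc inside a clique, so the arc comes from an
      edge of \<open>G\<close>.\<close>
    then have "(x, y) \<notin> I" by (simp add: I_def)
    then have "(x, y) \<in> C" using that(1) unfolding arcs' by blast
    then obtain i j where ij: "x = p i j" "y = p j i" "(i, j) \<in> parcs G"
      unfolding C_def by auto
    then have "(j, i) \<in> parcs G" using G.parcs_sym by blast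
    then have "k x = i" "k y = j"
      using ij k[of i x] k[of j y] p[of i j] p[of j i] G.in_arcsD1 by simp_all
    then show ?thesis using ij by simp
  qed
  have "clique_partition F k" unfolding clique_partition_def
  proof (intro conjI ballI allI impI)
    fix x y assume "x \<in> pverts F" "y \<in> pverts F" "k x = k y" "x \<noteq> y"
    then have "k x \<in> pverts G \<and> x \<in> V (k x) \<and> y \<in> V (k x)" using k unfolding verts by force
    then show "(x, y) \<in> parcs F" using \<open>x \<noteq> y\<close> unfolding arcs' I_def by auto
  next
    fix x y z assume "(x, y) \<in> parcs F" "(x, z) \<in> parcs F" "k x \<noteq> k y" "k x \<noteq> k z"
    then have xy: "(k x, k y) \<in> parcs G" "x = p (k x) (k y)" "y = p (k y) (k x)"
      and xz: "(k x, k z) \<in> parcs G" "x = p (k x) (k z)" "z = p (k z) (k x)"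
      using cross by blast+
    have "p (k x) (k y) = p (k x) (k z)" using xy xz by metis
    then have "k y = k z" using inj_onD[OF inj, of "(k x, k y)" "(k x, k z)"] xy(1) xz(1) by simp
    then show "y = z" using xy xz by metis
  next
    fix x y x' y'
    assume *: "(x, y) \<in> parcs F" "(x', y') \<in> parcs F" "k x = k x'" "k y = k y'" "k x \<noteq> k y"
    then have "x = p (k x) (k y)" "x' = p (k x') (k y')"
      using cross[of x y] cross[of x' y'] by simp_all
    with * show "x = x'" by simp
  qed
  then show thesis by (rule that)
qed

text \<open>The base graph is the quotient by the classes. Uniqueness of the crossing arc between
  two classes makes its end \<open>p i j\<close> well defined, and uniqueness of the crossing arc at
  a vertex makes \<open>p\<close> injective.\<close>

lemma clique_partition_imp_expanded_clique_graph:
  assumes "pair_graph F" and "clique_partition F k"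
  shows "expanded_clique_graph F"
proof -
  interpret pair_graph F by fact
  have clique: "(x, y) \<in> parcs F" if "x \<in> pverts F" "y \<in> pverts F" "k x = k y" "x \<noteq> y" for x y
    using assms(2) that unfolding clique_partition_def by blast
  have uniq: "x = x'"
    if "(x, y) \<in> parcs F" "(x', y') \<in> parcs F" "k x = k x'" "k y = k y'" "k x \<noteq> k y" for x y x' y'
    using assms(2) that unfolding clique_partition_def by blast
  have match: "y = z" if "(x, y) \<in> parcs F" "(x, z) \<in> parcs F" "k x \<noteq> k y" "k x \<noteq> k z" for x y z
    using assms(2) that unfolding clique_partition_def by blast
  define G where "G = \<lparr>pverts = k ` pverts F,
    parcs = {(k x, k y) |x y. (x, y) \<in> parcs F \<and> k x \<noteq> k y}\<rparr>"
  define V where "V i = {x \<in> pverts F. k x = i}" for i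
  define f where "f i = card (V i)" for i
  define p where "p i j = (SOME x. \<exists>y. (x, y) \<in> parcs F \<and> k x = i \<and> k y = j)" for i j
  have p: "p (k x) (k y) = x" if "(x, y) \<in> parcs F" "k x \<noteq> k y" for x y
  proof -
    have "\<exists>z. (p (k x) (k y), z) \<in> parcs F \<and> k (p (k x) (k y)) = k x \<and> k z = k y"
      unfolding p_def by (rule someI_ex) (use that in blast)
    then show ?thesis using that uniq by metis
  qed
  have "finite (pverts G)" by (simp add: G_def)
  moreover have sub: "parcs G \<subseteq> pverts G \<times> pverts G"
    unfolding G_def by (auto dest: wellformed')
  ultimately have fin: "finite (parcs G)" by (meson finite_SigmaI finite_subset)
  have arcD: "fst e \<in> pverts G \<and> snd e \<in> pverts G \<and> fst e \<noteq> snd e" if "e \<in> parcs G" for e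
  proof -
    have "fst e \<noteq> snd e" using that by (auto simp: G_def)
    then show ?thesis using subsetD[OF sub that] by (simp add: mem_Times_iff)
  qed
  have "sym (parcs G)"
  proof (rule symI)
    fix i j assume "(i, j) \<in> parcs G"
    then obtain x y where "(x, y) \<in> parcs F" "k x \<noteq> k y" "i = k x" "j = k y"
      by (auto simp: G_def)
    moreover from this have "(y, x) \<in> parcs F" using parcs_sym by blast
    ultimately have "\<exists>u v. (j, i) = (k u, k v) \<and> (u, v) \<in> parcs F \<and> k u \<noteq> k v" by metis
    then show "(j, i) \<in> parcs G" by (simp add: G_def)
  qed
  then have G: "pair_graph G"
    using \<open>finite (pverts G)\<close> fin arcD by unfold_locales (auto simp: symmetric_def)
  have pV: "p i j \<in> V i" if "(i, j) \<in> parcs G" for i j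
    using that p in_arcsD1 by (fastforce simp: G_def V_def)
  have inj: "inj_on (\<lambda>(i, j). p i j) (parcs G)"
  proof (rule inj_onI)
    fix e e' assume e: "e \<in> parcs G" "e' \<in> parcs G" "(\<lambda>(i, j). p i j) e = (\<lambda>(i, j). p i j) e'"
    obtain x y where xy: "(x, y) \<in> parcs F" "k x \<noteq> k y" "e = (k x, k y)"
      using e by (auto simp: G_def)
    obtain x' y' where xy': "(x', y') \<in> parcs F" "k x' \<noteq> k y'" "e' = (k x', k y')"
      using e by (auto simp: G_def)
    have "x = x'" using e(3) p xy xy' by simp
    then have "y = y'" using match xy xy' by metis
    then show "e = e'" using \<open>x = x'\<close> xy xy' by simp
  qed
  have finV: "finite (V i)" for i by (simp add: V_def)
  have deg: "deg G i \<le> f i" for i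
  proof -
    \<comment> \<open>The degree bound holds because \<open>p\<close> maps the arcs leaving
      \<open>i\<close> injectively into the class \<open>V i\<close>.\<close>
    have "inj_on (\<lambda>(i, j). p i j) (out_arcs (with_proj G) i)"
      by (rule inj_on_subset[OF inj]) auto
    moreover have "(\<lambda>(i, j). p i j) ` out_arcs (with_proj G) i \<subseteq> V i" using pV by auto
    ultimately show ?thesis unfolding out_degree_def f_def using finV by (rule card_inj_on_le)
  qed
  have arcs: "parcs F = {(x, y). x \<noteq> y \<and> (\<exists>i \<in> pverts G. x \<in> V i \<and> y \<in> V i)}
      \<union> {(p i j, p j i) | i j. (i, j) \<in> parcs G}" (is "_ = ?I \<union> ?C")
  proof (intro equalityI subrelI)
    fix x y assume xy: "(x, y) \<in> parcs F"
    show "(x, y) \<in> ?I \<union> ?C"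
    proof (cases "k x = k y")
      case True
      then show ?thesis using xy parcs_irrefl wellformed' by (auto simp: G_def V_def)
    next
      case False
      then have "p (k x) (k y) = x" "p (k y) (k x) = y" "(k x, k y) \<in> parcs G"
        using p[OF xy] p[of y x] xy parcs_sym[of x y] by (auto simp: G_def)
      then have "(x, y) = (p (k x) (k y), p (k y) (k x)) \<and> (k x, k y) \<in> parcs G" by simp
      then have "(x, y) \<in> ?C" by (intro CollectI exI)
      then show ?thesis by (rule UnI2)
    qed
  next
    fix x y assume "(x, y) \<in> ?I \<union> ?C"
    then show "(x, y) \<in> parcs F"
    proof
      assume "(x, y) \<in> ?I"
      then show ?thesis using clique by (auto simp: V_def)
    next
      assume "(x, y) \<in> ?C"
      then obtain i j where ij: "x = p i j" "y = p j i" "(i, j) \<in> parcs G" by blast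
      then obtain u v where uv: "(u, v) \<in> parcs F" "k u \<noteq> k v" "i = k u" "j = k v"
        by (auto simp: G_def)
      then have "x = u" "y = v" using ij p[of u v] p[of v u] parcs_sym[of u v] by auto
      then show ?thesis using uv by simp
    qed
  qed
  have "expanded_clique_graph_of G f F"
    unfolding expanded_clique_graph_of_def
  proof (intro conjI exI[of _ V] exI[of _ p])
    show "pverts F = (\<Union>i\<in>pverts G. V i)" by (auto simp: G_def V_def)
    show "disjoint_family_on V (pverts G)" by (auto simp: disjoint_family_on_def V_def)
    show "\<forall>i\<in>pverts G. card (V i) = f i" by (simp add: f_def)
    show "\<forall>(i, j)\<in>parcs G. p i j \<in> V i" using pV by blast
    show "\<forall>v\<in>pverts G. deg G v \<le> f v" using deg by blast
  qed (fact G assms inj arcs)+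
  then show ?thesis unfolding expanded_clique_graph_def by blast
qed

section \<open>Clique partitions exclude the forbidden configurations\<close>

lemma (in pair_graph) deg_eq_card: "deg G v = card {w. (v, w) \<in> parcs G}"
proof -
  have "out_arcs (with_proj G) v = Pair v ` {w. (v, w) \<in> parcs G}" by auto
  then show ?thesis by (simp add: out_degree_def card_image inj_on_def)
qed

lemma (in pair_graph) finite_nbrs: "finite {w. (v, w) \<in> parcs G}"
  by (rule finite_subset[OF _ pair_finite_verts]) (auto dest: in_arcsD2)

text \<open>If \<open>xy\<close> were crossing, it would be the only crossing edge at
  \<open>x\<close> and at \<open>y\<close>, so \<open>z\<close> would belong to the classes of
  both.\<close>

lemma (in pair_graph) clique_partition_triangle:
  assumes "clique_partition G k" "(x, y) \<in> parcs G" "(y, z) \<in> parcs G" "(x, z) \<in> parcs G"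
  shows "k x = k y"
proof (rule ccontr)
  assume xy: "k x \<noteq> k y"
  have match: "b = c" if "(a, b) \<in> parcs G" "(a, c) \<in> parcs G" "k a \<noteq> k b" "k a \<noteq> k c" for a b c
    using assms(1) that unfolding clique_partition_def by blast
  have "y \<noteq> z" "x \<noteq> z" using assms parcs_irrefl by auto
  then have "k x = k z" "k y = k z"
    using match[of x y z] match[of y x z] assms xy parcs_sym[of x y] by auto
  then show False using xy by simp
qed

context pair_graph
begin

context
  fixes k :: "'a \<Rightarrow> nat"
  assumes part: "clique_partition G k"
begin

lemma clique: "\<lbrakk>x \<in> pverts G; y \<in> pverts G; k x = k y; x \<noteq> y\<rbrakk> \<Longrightarrow> (x, y) \<in> parcs G"
  using part unfolding clique_partition_def by blast

lemma cross_unique: "\<lbrakk>(x, y) \<in> parcs G; (x, z) \<in> parcs G; k x \<noteq> k y; k x \<noteq> k z\<rbrakk> \<Longrightarrow> y = z"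
  using part unfolding clique_partition_def by blast

lemma inner_trans:
  "\<lbrakk>(x, y) \<in> parcs G; (y, z) \<in> parcs G; k x = k y; k y = k z; x \<noteq> z\<rbrakk> \<Longrightarrow> (x, z) \<in> parcs G"
  using clique wellformed' by (metis (no_types))

text \<open>The alternation along induced paths: two inner edges would force the chord
  \<open>xz\<close>, and two crossing edges would contradict uniqueness at \<open>y\<close>.\<close>

lemma inner_iff_cross:
  assumes "(x, y) \<in> parcs G" "(y, z) \<in> parcs G" "x \<noteq> z" "(x, z) \<notin> parcs G"
  shows "k x = k y \<longleftrightarrow> k y \<noteq> k z"
  using inner_trans[of x y z] cross_unique[of y x z] parcs_sym[of x y] assms by metis

text \<open>Two of the three edges at the centre are of the same type, against the
  alternation.\<close>

lemma no_claw_of_partition: "\<not> contains_claw G"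
proof
  assume "contains_claw G"
  then obtain v a b c where "(v, a) \<in> parcs G" "(v, b) \<in> parcs G" "(v, c) \<in> parcs G"
    "a \<noteq> b" "a \<noteq> c" "b \<noteq> c" "(a, b) \<notin> parcs G" "(a, c) \<notin> parcs G" "(b, c) \<notin> parcs G"
    unfolding contains_claw_iff[OF pair_graph_axioms] by blast
  then show False
    using inner_iff_cross[of a v b] inner_iff_cross[of a v c] inner_iff_cross[of b v c]
      parcs_sym[of v] by auto
qed

text \<open>Each triangle lies in one class, and the two triangles share a vertex, so the
  non-adjacent vertices would lie in one clique. The butterfly is excluded by the same
  argument.\<close>

lemma no_diamond_of_partition: "\<not> contains_induced G diamond_graph"
proof
  assume "contains_induced G diamond_graph"
  then obtain a b c d where *: "b \<noteq> d" "(a, b) \<in> parcs G" "(b, c) \<in> parcs G" "(c, d) \<in> parcs G"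
    "(d, a) \<in> parcs G" "(a, c) \<in> parcs G" "(b, d) \<notin> parcs G"
    unfolding contains_diamond_iff[OF pair_graph_axioms] by blast
  have "(b, a) \<in> parcs G" "(a, d) \<in> parcs G" "(d, c) \<in> parcs G" using * parcs_sym by blast+
  then have "k b = k a" "k a = k d"
    using clique_partition_triangle[OF part, of b a c]
      clique_partition_triangle[OF part, of a d c] *
    by auto
  then show False using inner_trans[of b a d] * \<open>(b, a) \<in> parcs G\<close> \<open>(a, d) \<in> parcs G\<close> by blast
qed

lemma no_butterfly_of_partition: "\<not> contains_induced G butterfly_graph"
proof
  assume "contains_induced G butterfly_graph"
  then obtain v a b c d where *: "(v, a) \<in> parcs G" "(a, b) \<in> parcs G" "(b, v) \<in> parcs G"
    "(v, c) \<in> parcs G" "(c, d) \<in> parcs G" "(d, v) \<in> parcs G" "a \<noteq> c" "(a, c) \<notin> parcs G"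
    unfolding contains_butterfly_iff[OF pair_graph_axioms] by blast
  have sym: "(a, v) \<in> parcs G" "(v, b) \<in> parcs G" "(v, d) \<in> parcs G" using * parcs_sym by blast+
  then have "k a = k v" "k v = k c"
    using clique_partition_triangle[OF part, of v a b]
      clique_partition_triangle[OF part, of v c d] *
    by auto
  then show False using inner_trans[of a v c] * sym by blast
qed

text \<open>The edges alternate around the cycle, so two opposite crossing edges would join the same
  two classes.\<close>

lemma no_C4_of_partition: "\<not> contains_induced G (cycle_graph 4)"
proof
  assume "contains_induced G (cycle_graph 4)"
  then obtain a b c d where *: "a \<noteq> c" "b \<noteq> d"
    "(a, b) \<in> parcs G" "(b, c) \<in> parcs G" "(c, d) \<in> parcs G" "(d, a) \<in> parcs G"
    "(a, c) \<notin> parcs G" "(b, d) \<notin> parcs G"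
    unfolding contains_C4_iff[OF pair_graph_axioms] by blast
  have sym: "(b, a) \<in> parcs G" "(c, b) \<in> parcs G" "(d, c) \<in> parcs G" "(a, d) \<in> parcs G"
    "(c, a) \<notin> parcs G" "(d, b) \<notin> parcs G"
    using * by (simp_all add: parcs_sym)
  have alt: "k a = k b \<longleftrightarrow> k b \<noteq> k c" "k b = k c \<longleftrightarrow> k c \<noteq> k d" "k c = k d \<longleftrightarrow> k d \<noteq> k a"
    using inner_iff_cross[of a b c] inner_iff_cross[of b c d] inner_iff_cross[of c d a] * sym
    by simp_all
  have uniq: "x = x'" if "(x, y) \<in> parcs G" "(x', y') \<in> parcs G" "k x = k x'" "k y = k y'" "k x \<noteq> k y"
    for x y x' y'
    using part that unfolding clique_partition_def by blast
  show False
  proof (cases "k a = k b")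
    case True
    then show False using uniq[of a d b c] alt * sym by simp
  next
    case False
    then have "k b = k c" "k a = k d" using alt by metis+
    then have "b = c" using uniq[of b a c d] False * sym by metis
    then show False using * by simp
  qed
qed

text \<open>Inner and crossing edges alternate around the hole, which is impossible for an odd
  number of edges.\<close>

lemma no_odd_hole_of_partition: "\<not> contains_odd_hole G"
proof
  assume "contains_odd_hole G"
  then obtain q g where q: "odd q" "4 < q" and inj: "inj_on g {..<q}"
    and g: "\<And>i j. i < q \<Longrightarrow> j < q \<Longrightarrow> j = Suc i mod q \<or> i = Suc j mod q \<longleftrightarrow> (g i, g j) \<in> parcs G"
    unfolding contains_odd_hole_def contains_cycle_iff[OF pair_graph_axioms] by blast
  have mod: "Suc i mod q = (if Suc i = q then 0 else Suc i)" if "i < q" for i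
    using that by (simp add: mod_Suc)
  define I where "I i \<longleftrightarrow> k (g i) = k (g (Suc i mod q))" for i
  have alt: "I i \<longleftrightarrow> \<not> I (Suc i mod q)" if i: "i < q" for i
  proof -
    let ?j = "Suc i mod q" and ?l = "Suc (Suc i mod q) mod q"
    have lt: "?j < q" "?l < q" using q by simp_all
    have "i \<noteq> ?l" "\<not> (?l = Suc i mod q \<or> i = Suc ?l mod q)"
      using i q lt by (auto simp: mod split: if_splits)
    then have "(g i, g ?l) \<notin> parcs G" "g i \<noteq> g ?l"
      using g[OF i lt(2)] inj i lt by (auto dest: inj_onD)
    moreover have "(g i, g ?j) \<in> parcs G" "(g ?j, g ?l) \<in> parcs G"
      using g[OF i lt(1)] g[OF lt] by simp_all
    ultimately show ?thesis unfolding I_def using inner_iff_cross by blast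
  qed
  have "I i \<longleftrightarrow> (I 0 \<longleftrightarrow> even i)" if "i < q" for i
    using that
  proof (induction i)
    case (Suc i)
    then show ?case using alt[of i] by auto
  qed simp
  \<comment> \<open>The index \<open>q - 1\<close> is even, so the last edge has the type of the
    edge at index 0, although the two are consecutive on the cycle.\<close>
  from this[of "q - 1"] have "I (q - 1) \<longleftrightarrow> I 0" using q by simp
  moreover have "Suc (q - 1) mod q = 0" using q by simp
  ultimately show False using alt[of "q - 1"] q by simp
qed

text \<open>A chain cannot have an inner edge at an end of degree at least 3. Such an end
  \<open>u\<close> has at most one crossing neighbour, hence a second inner neighbour, which
  together with \<open>u\<close> and \<open>w\<close> gives \<open>v\<close> three
  neighbours.\<close>

lemma inner_deg_2:
  assumes uv: "(u, v) \<in> parcs G" "k u = k v" and vw: "(v, w) \<in> parcs G" "k v \<noteq> k w"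
    and "3 \<le> deg G u"
  shows "deg G v \<noteq> 2"
proof
  assume "deg G v = 2"
  let ?N = "{x. (u, x) \<in> parcs G}"
  have "\<exists>x. (u, x) \<in> parcs G \<and> x \<noteq> v \<and> k x = k u"
  proof (rule ccontr)
    assume "\<nexists>x. (u, x) \<in> parcs G \<and> x \<noteq> v \<and> k x = k u"
    then have sub: "?N - {v} \<subseteq> {x. (u, x) \<in> parcs G \<and> k u \<noteq> k x}" by auto
    have "\<exists>y. {x. (u, x) \<in> parcs G \<and> k u \<noteq> k x} \<subseteq> {y}"
      using cross_unique[of u] by blast
    then obtain y where "{x. (u, x) \<in> parcs G \<and> k u \<noteq> k x} \<subseteq> {y}" ..
    with sub have "?N \<subseteq> {v, y}" by blast
    then have "card ?N \<le> card {v, y}" by (rule card_mono[rotated]) simp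
    also have "\<dots> \<le> 2" by (simp add: card_insert_if)
    finally show False using assms(5) by (simp add: deg_eq_card)
  qed
  then obtain x where x: "(u, x) \<in> parcs G" "x \<noteq> v" "k x = k u" by blast
  have "(v, u) \<in> parcs G" using uv parcs_sym by blast
  then have "(v, x) \<in> parcs G" using inner_trans[of v u x] x uv by metis
  with \<open>(v, u) \<in> parcs G\<close> vw have "{u, x, w} \<subseteq> {y. (v, y) \<in> parcs G}" by auto
  then have "card {u, x, w} \<le> deg G v"
    unfolding deg_eq_card using finite_nbrs by (rule card_mono[rotated])
  moreover have "card {u, x, w} = 3" using x uv vw parcs_irrefl by (auto simp: card_insert_if)
  ultimately show False using \<open>deg G v = 2\<close> by simp
qed

text \<open>A bad chain has an even number of edges, so by alternation exactly one of its first and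
  last edges is inner, and \<open>inner_deg_2\<close> applies at that end.\<close>

lemma no_bad_chain_of_partition: "\<not> bad_chain G us"
proof
  assume "bad_chain G us"
  then have pre: "prechain G us" and odd: "odd (length us)"
    and deg: "3 \<le> deg G (hd us)" "3 \<le> deg G (last us)"
    unfolding bad_chain_def chain_def by auto
  define n where "n = length us"
  have n: "3 \<le> n" "odd n" and dist: "distinct us"
    and ind: "\<And>i j. i < j \<Longrightarrow> j < n \<Longrightarrow> (us ! i, us ! j) \<in> parcs G \<Longrightarrow> j = Suc i"
    and deg2: "\<And>i. 0 < i \<Longrightarrow> i < n - 1 \<Longrightarrow> deg G (us ! i) = 2"
    using pre odd unfolding prechain_def n_def vpath_def by auto
  have arc: "(us ! i, us ! Suc i) \<in> parcs G" if "Suc i < n" for i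
  proof -
    have "set (vwalk_arcs us) \<subseteq> parcs G"
      using pre unfolding prechain_def vpath_def vwalk_def by simp
    moreover have "(us ! i, us ! Suc i) \<in> set (vwalk_arcs us)"
      using that unfolding n_def
    proof (induction us arbitrary: i rule: vwalk_arcs.induct)
      case (3 x y xs)
      then show ?case by (cases i) auto
    qed simp_all
    ultimately show ?thesis by blast
  qed
  define I where "I i \<longleftrightarrow> k (us ! i) = k (us ! Suc i)" for i
  have alt: "I i \<longleftrightarrow> \<not> I (Suc i)" if "Suc (Suc i) < n" for i
  proof -
    have "us ! i \<noteq> us ! Suc (Suc i)"
      using dist that unfolding n_def by (simp add: nth_eq_iff_index_eq)
    moreover have "(us ! i, us ! Suc (Suc i)) \<notin> parcs G" using ind[of i "Suc (Suc i)"] that by auto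
    ultimately show ?thesis unfolding I_def using inner_iff_cross arc that by (meson Suc_lessD)
  qed
  have par: "I i \<longleftrightarrow> (I 0 \<longleftrightarrow> even i)" if "Suc i < n" for i
    using that
  proof (induction i)
    case (Suc i)
    then show ?case using alt[of i] by auto
  qed simp
  have ends: "hd us = us ! 0" "last us = us ! (n - 1)"
    using n unfolding n_def by (cases "us = []"; simp add: hd_conv_nth last_conv_nth)+
  show False
  proof (cases "I 0")
    case True
    then have "deg G (us ! 1) \<noteq> 2"
      using inner_deg_2[of "us ! 0" "us ! 1" "us ! 2"] arc[of 0] arc[of 1] alt[of 0] n deg ends
      unfolding I_def by (simp add: numeral_2_eq_2)
    moreover have "1 < n - 1" using n(1) by linarith
    ultimately show False using deg2[of 1] by simp
  next
    case False
    \<comment> \<open>The last two edges have the indices \<open>m\<close> and \<open>Suc m\<close>;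
      the latter is odd, so the last edge is inner when the first is crossing. The chain is then
      read backwards.\<close>
    obtain m where m: "n = Suc (Suc (Suc m))"
      using n(1) that[of "n - 3"] by linarith
    have "even m" using n(2) unfolding m by simp
    then have "I (Suc m)" "\<not> I m" using par[of "Suc m"] par[of m] False unfolding m by auto
    moreover have "(us ! Suc (Suc m), us ! Suc m) \<in> parcs G" "(us ! Suc m, us ! m) \<in> parcs G"
      using arc[of m] arc[of "Suc m"] by (simp_all add: m parcs_sym)
    ultimately have "deg G (us ! Suc m) \<noteq> 2"
      using inner_deg_2[of "us ! Suc (Suc m)" "us ! Suc m" "us ! m"] deg ends m
      unfolding I_def by simp
    then show False using deg2[of "Suc m"] m by simp
  qed
qed

end

end

subsection \<open>Constructing a clique partition\<close>

context pair_graph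
begin

text \<open>These arcs have to become inner, by \<open>clique_partition_triangle\<close>. The set
  \<open>Domain triangle_arcs\<close> consists of the vertices lying on a triangle.\<close>

definition triangle_arcs :: "'a rel" where
  "triangle_arcs = {(x, y). (x, y) \<in> parcs G \<and> (\<exists>z. (x, z) \<in> parcs G \<and> (y, z) \<in> parcs G)}"

lemma triangle_arcs_sym: "(x, y) \<in> triangle_arcs \<longleftrightarrow> (y, x) \<in> triangle_arcs"
  unfolding triangle_arcs_def using parcs_sym[of x y] by auto

lemma triangle_arcsD: "(x, y) \<in> triangle_arcs \<Longrightarrow> (x, y) \<in> parcs G"
  by (simp add: triangle_arcs_def)

lemma in_triangle_verts:
  assumes "(x, y) \<in> parcs G" "(x, z) \<in> parcs G" "(y, z) \<in> parcs G"
  shows "x \<in> Domain triangle_arcs"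
  using assms unfolding triangle_arcs_def by blast

text \<open>Take a triangle on each of the two arcs. If \<open>x\<close> and \<open>z\<close> were
  not adjacent, the two triangles would form a butterfly with centre \<open>y\<close>; once they are
  adjacent, \<open>y\<close> completes a triangle on \<open>xz\<close>.\<close>

lemma triangle_arcs_trans:
  assumes no_diamond: "\<not> contains_induced G diamond_graph"
    and no_butterfly: "\<not> contains_induced G butterfly_graph"
    and xy: "(x, y) \<in> triangle_arcs" and yz: "(y, z) \<in> triangle_arcs" and "x \<noteq> z"
  shows "(x, z) \<in> triangle_arcs"
proof -
  have dia: "(b, d) \<in> parcs G"
    if "b \<noteq> d" "(a, b) \<in> parcs G" "(b, c) \<in> parcs G" "(c, d) \<in> parcs G" "(d, a) \<in> parcs G"
      "(a, c) \<in> parcs G" for a b c d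
    using no_diamond that unfolding contains_diamond_iff[OF pair_graph_axioms] by blast
  obtain t where t: "(x, y) \<in> parcs G" "(x, t) \<in> parcs G" "(y, t) \<in> parcs G"
    using xy by (auto simp: triangle_arcs_def)
  obtain s where s: "(y, z) \<in> parcs G" "(y, s) \<in> parcs G" "(z, s) \<in> parcs G"
    using yz by (auto simp: triangle_arcs_def)
  have sym: "(y, x) \<in> parcs G" "(t, x) \<in> parcs G" "(t, y) \<in> parcs G"
    "(z, y) \<in> parcs G" "(s, y) \<in> parcs G" "(s, z) \<in> parcs G"
    using s t by (simp_all add: parcs_sym)
  have "(x, z) \<in> parcs G"
  proof (rule ccontr)
    assume xz: "(x, z) \<notin> parcs G"
    \<comment> \<open>All four other vertices are neighbours of \<open>y\<close>, so a further arc
      between the two triangles would create a diamond with a chord at \<open>y\<close>.\<close>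
    have tz: "(t, z) \<notin> parcs G" using dia[of x z y t] t sym s xz \<open>x \<noteq> z\<close> by blast
    have xs: "(x, s) \<notin> parcs G" using dia[of x z y s] t sym s xz \<open>x \<noteq> z\<close> by blast
    have ts: "(t, s) \<notin> parcs G" using dia[of x s y t] t sym s xs xz by blast
    have "t \<noteq> z" "t \<noteq> s" "x \<noteq> s" using t s sym xz tz by auto
    then show False
      using no_butterfly xz tz xs ts t s sym \<open>x \<noteq> z\<close>
      unfolding contains_butterfly_iff[OF pair_graph_axioms] by blast
  qed
  then show ?thesis using t s sym unfolding triangle_arcs_def by blast
qed

section \<open>Paths that can branch only at their ends\<close>

lemma path_arc_cases:
  assumes inner: "\<And>i x. \<lbrakk>0 < i; Suc i < m; (u i, x) \<in> parcs G\<rbrakk> \<Longrightarrow> x = u (i - 1) \<or> x = u (Suc i)"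
    and inj: "inj_on u {..<m}" and ij: "i < j" "j < m" "(u i, u j) \<in> parcs G"
  shows "j = Suc i \<or> i = 0 \<and> Suc j = m"
proof (cases "i = 0")
  case False
  \<comment> \<open>An inner vertex is adjacent only to its neighbours on the path, so a chord can
    join only the two ends.\<close>
  then have "u j = u (i - 1) \<or> u j = u (Suc i)" using inner[of i "u j"] ij by simp
  then have "j = i - 1 \<or> j = Suc i" using inj ij by (auto dest: inj_onD)
  then show ?thesis using ij by auto
next
  case True
  show ?thesis
  proof (cases "Suc j = m")
    case False
    then have "u i = u (j - 1) \<or> u i = u (Suc j)" using inner[of j "u i"] ij parcs_sym by simp
    then have "i = j - 1 \<or> i = Suc j" using inj ij False by (auto dest: inj_onD)
    then show ?thesis using ij by auto
  qed (use True in simp)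
qed

text \<open>By \<open>path_arc_cases\<close> the closing arc is the only arc besides the path edges,
  so the cycle is induced.\<close>

lemma odd_hole_of_closed_path:
  assumes inner: "\<And>i x. \<lbrakk>0 < i; Suc i < m; (u i, x) \<in> parcs G\<rbrakk> \<Longrightarrow> x = u (i - 1) \<or> x = u (Suc i)"
    and inj: "inj_on u {..<m}" and arc: "\<And>i. Suc i < m \<Longrightarrow> (u i, u (Suc i)) \<in> parcs G"
    and closed: "(u 0, u (m - 1)) \<in> parcs G" and m: "odd m" "4 < m"
  shows "contains_odd_hole G"
proof -
  have mod: "Suc i mod m = (if Suc i = m then 0 else Suc i)" if "i < m" for i
    using that by (simp add: mod_Suc)
  have closed': "(u (m - 1), u 0) \<in> parcs G" using closed parcs_sym by blast
  have sub: "u ` {..<m} \<subseteq> pverts G"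
  proof
    fix x assume "x \<in> u ` {..<m}"
    then obtain i where i: "i < m" "x = u i" by auto
    show "x \<in> pverts G"
    proof (cases "Suc i < m")
      case True
      then show ?thesis using arc i in_arcsD1 by blast
    next
      case False
      then have "i = m - 1" using i by simp
      then show ?thesis using i closed' in_arcsD1 by blast
    qed
  qed
  have succ: "(u i, u (Suc i mod m)) \<in> parcs G" if "i < m" for i
  proof (cases "Suc i = m")
    case True
    then have "i = m - 1" by simp
    then show ?thesis using closed' True by simp
  qed (use that arc mod in simp)
  have lt: "j = Suc i mod m \<or> i = Suc j mod m" if "i < j" "j < m" "(u i, u j) \<in> parcs G" for i j
  proof -
    have "j = Suc i \<or> i = 0 \<and> Suc j = m" by (rule path_arc_cases[OF inner inj that])
    then show ?thesis using that by auto
  qed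
  have "j = Suc i mod m \<or> i = Suc j mod m \<longleftrightarrow> (u i, u j) \<in> parcs G" if "i < m" "j < m" for i j
  proof
    assume "j = Suc i mod m \<or> i = Suc j mod m"
    then show "(u i, u j) \<in> parcs G" using succ that parcs_sym by blast
  next
    assume a: "(u i, u j) \<in> parcs G"
    then have "i \<noteq> j" using parcs_irrefl by auto
    then consider "i < j" | "j < i" by linarith
    then show "j = Suc i mod m \<or> i = Suc j mod m"
    proof cases
      case 1
      then show ?thesis using lt a that by blast
    next
      case 2
      then show ?thesis using lt[of j i] a that parcs_sym by blast
    qed
  qed
  then have "contains_induced G (cycle_graph m)"
    unfolding contains_cycle_iff[OF pair_graph_axioms] using inj sub by blast
  then show ?thesis unfolding contains_odd_hole_def using m by blast
qed

text \<open>Without the closing arc the path is induced. It is maximal because any extension would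
  turn an end of degree at least 3 into an inner vertex of a chain.\<close>

lemma bad_chain_of_path:
  assumes inner: "\<And>i x. \<lbrakk>0 < i; Suc i < m; (u i, x) \<in> parcs G\<rbrakk> \<Longrightarrow> x = u (i - 1) \<or> x = u (Suc i)"
    and inj: "inj_on u {..<m}" and arc: "\<And>i. Suc i < m \<Longrightarrow> (u i, u (Suc i)) \<in> parcs G"
    and nclosed: "(u 0, u (m - 1)) \<notin> parcs G" and m: "odd m" "3 \<le> m"
    and deg: "3 \<le> deg G (u 0)" "3 \<le> deg G (u (m - 1))"
  shows "bad_chain G (map u [0..<m])"
proof -
  let ?us = "map u [0..<m]"
  have arcs: "set (vwalk_arcs (map u [0..<l])) \<subseteq> parcs G" if "l \<le> m" for l
    using that
  proof (induction l)
    case (Suc l)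
    show ?case
    proof (cases l)
      case (Suc l')
      then have ne: "map u [0..<l] \<noteq> []" by simp
      have "(last (map u [0..<l]), u l) \<in> parcs G"
        using arc[of l'] Suc Suc.prems by (simp add: last_map)
      then show ?thesis using Suc.IH Suc.prems vwalk_arcs_append[OF ne, of "[u l]"] by simp
    qed simp
  qed simp
  have "u i \<in> pverts G" if "i < m" for i
  proof (cases "Suc i < m")
    case True
    then show ?thesis using arc in_arcsD1 by blast
  next
    case False
    then have "i = Suc (m - 2)" using that m by simp
    then show ?thesis using arc[of "m - 2"] in_arcsD2 that by auto
  qed
  then have "set ?us \<subseteq> pverts G" by auto
  then have path: "vpath ?us (with_proj G)"
    unfolding vpath_def vwalk_def using arcs[of m] inj m
    by (auto simp: distinct_map lessThan_atLeast0)
  have ind: "j = Suc i" if "i < j" "j < m" "(u i, u j) \<in> parcs G" for i j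
  proof -
    have "j = Suc i \<or> i = 0 \<and> Suc j = m" by (rule path_arc_cases[OF inner inj that])
    moreover have "j = m - 1" if "Suc j = m" using that by simp
    ultimately show ?thesis using nclosed that by auto
  qed
  have deg2: "deg G (u i) = 2" if i: "0 < i" "Suc i < m" for i
  proof -
    have "(u (i - 1), u i) \<in> parcs G" using arc[of "i - 1"] i by simp
    then have "{x. (u i, x) \<in> parcs G} = {u (i - 1), u (Suc i)}"
      using inner[OF i] arc[OF i(2)] parcs_sym by auto
    moreover have "u (i - 1) \<noteq> u (Suc i)"
      using inj_onD[OF inj, of "i - 1" "Suc i"] i by (cases i) auto
    ultimately show ?thesis by (simp add: deg_eq_card)
  qed
  have pre: "prechain G ?us" unfolding prechain_def
  proof (intro conjI allI impI)
    fix i j assume "i < j \<and> j < length ?us \<and> (?us ! i, ?us ! j) \<in> parcs G"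
    then show "j = Suc i" using ind[of i j] by auto
  next
    fix i assume "0 < i \<and> i < length ?us - 1"
    then have "0 < i" "Suc i < m" by auto
    then show "deg G (?us ! i) = 2" using deg2[of i] by simp
  qed (use m path in simp_all)
  have ends: "hd ?us = u 0" "last ?us = u (m - 1)" using m by (simp_all add: hd_map last_map)
  have "xs = [] \<and> ys = []" if "prechain G (xs @ ?us @ ys)" for xs ys
  proof (rule ccontr)
    let ?l = "xs @ ?us @ ys"
    have inner2: "deg G (?l ! i) = 2" if "0 < i" "i < length ?l - 1" for i
      using \<open>prechain G ?l\<close> that unfolding prechain_def by blast
    assume "\<not> (xs = [] \<and> ys = [])"
    then consider "xs \<noteq> []" | "ys \<noteq> []" by blast
    then show False
    proof cases
      case 1
      then have "deg G (?l ! length xs) = 2" using inner2[of "length xs"] m by simp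
      moreover have "?l ! length xs = u 0" using m by (simp add: nth_append)
      ultimately show False using deg by simp
    next
      case 2
      then have "0 < length ys" by simp
      moreover have "length ?l = length xs + m + length ys" by simp
      ultimately have "length xs + (m - 1) < length ?l - 1" "0 < length xs + (m - 1)"
        using m(2) by linarith+
      then have "deg G (?l ! (length xs + (m - 1))) = 2" by (rule inner2[rotated])
      moreover have "?l ! (length xs + (m - 1)) = u (m - 1)"
        using m unfolding nth_append_length_plus by (simp add: nth_append)
      ultimately show False using deg by simp
    qed
  qed
  then show ?thesis unfolding bad_chain_def chain_def using pre ends deg m by simp
qed

section \<open>Neighbourhoods in claw-free graphs\<close>

lemma at_most_two_nbrs:
  assumes "\<not> contains_claw G" and v: "v \<notin> Domain triangle_arcs"
    and arcs: "(v, a) \<in> parcs G" "(v, b) \<in> parcs G" "(v, c) \<in> parcs G" and "a \<noteq> b"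
  shows "c = a \<or> c = b"
proof (rule ccontr)
  assume "\<not> (c = a \<or> c = b)"
  \<comment> \<open>Neighbours of a vertex on no triangle are pairwise non-adjacent, so three of
    them form a claw.\<close>
  moreover have "(a, b) \<notin> parcs G" "(a, c) \<notin> parcs G" "(b, c) \<notin> parcs G"
    using in_triangle_verts[of v] arcs v by blast+
  ultimately show False
    using assms unfolding contains_claw_iff[OF pair_graph_axioms] by metis
qed

text \<open>Two such neighbours and a triangle neighbour \<open>p\<close> of \<open>x\<close> would
  form a claw: an arc among the three would put one of the edges \<open>xy\<close>,
  \<open>xz\<close> into a triangle.\<close>

lemma unique_nontriangle_arc:
  assumes no_claw: "\<not> contains_claw G" and "x \<in> Domain triangle_arcs"
    and y: "(x, y) \<in> parcs G - triangle_arcs" and z: "(x, z) \<in> parcs G - triangle_arcs"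
  shows "y = z"
proof (rule ccontr)
  assume "y \<noteq> z"
  obtain p where p: "(x, p) \<in> triangle_arcs" using assms by blast
  then have "(x, p) \<in> parcs G" by (rule triangle_arcsD)
  have "(y, p) \<notin> parcs G" "(z, p) \<notin> parcs G" "(y, z) \<notin> parcs G"
    using y z \<open>(x, p) \<in> parcs G\<close> by (auto simp: triangle_arcs_def)
  moreover have "y \<noteq> p" "z \<noteq> p" using y z p by auto
  ultimately show False
    using no_claw \<open>(x, p) \<in> parcs G\<close> y z \<open>y \<noteq> z\<close>
    unfolding contains_claw_iff[OF pair_graph_axioms] by blast
qed

text \<open>Supplies the degree condition at the ends of a bad chain: \<open>y\<close> comes in
  addition to the two triangle neighbours.\<close>

lemma deg_triangle_vertex:
  assumes "x \<in> Domain triangle_arcs" and y: "(x, y) \<in> parcs G - triangle_arcs"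
  shows "3 \<le> deg G x"
proof -
  obtain p q where pq: "(x, p) \<in> parcs G" "(x, q) \<in> parcs G" "(p, q) \<in> parcs G"
    using assms by (auto simp: triangle_arcs_def)
  then have "(q, p) \<in> parcs G" using parcs_sym by blast
  then have "(x, p) \<in> triangle_arcs" "(x, q) \<in> triangle_arcs"
    using pq unfolding triangle_arcs_def by blast+
  then have "y \<noteq> p" "y \<noteq> q" "p \<noteq> q" using y pq parcs_irrefl by auto
  then have "card {y, p, q} = 3" by simp
  moreover have "card {y, p, q} \<le> card {w. (x, w) \<in> parcs G}"
    by (rule card_mono[OF finite_nbrs]) (use y pq in simp)
  ultimately show ?thesis by (simp add: deg_eq_card)
qed

lemma nontriangle_arc:
  assumes "(x, y) \<in> parcs G" and "y \<notin> Domain triangle_arcs"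
  shows "(x, y) \<in> parcs G - triangle_arcs"
  using assms triangle_arcs_sym[of x y] by auto

text \<open>The colour True means crossing. Edges are coloured as doubletons, hence independently of
  direction. In an obstruction, consecutive edges share a vertex on no triangle; these vertices
  trace a path that yields a triangle, an odd hole or a bad chain.\<close>

lemma cross_coloring:
  assumes no_claw: "\<not> contains_claw G" and no_odd_hole: "\<not> contains_odd_hole G"
    and no_bad_chain: "\<nexists>us. bad_chain G us"
  obtains c where
    "\<And>v a b. \<lbrakk>(v, a) \<in> parcs G; (v, b) \<in> parcs G; a \<noteq> b; v \<notin> Domain triangle_arcs\<rbrakk>
      \<Longrightarrow> c {v, a} \<noteq> c {v, b}"
    and "\<And>x y. \<lbrakk>(x, y) \<in> parcs G - triangle_arcs; x \<in> Domain triangle_arcs\<rbrakk> \<Longrightarrow> c {x, y}"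
proof -
  define R where "R = {({v, a}, {v, b}) |v a b. (v, a) \<in> parcs G \<and> (v, b) \<in> parcs G \<and> a \<noteq> b \<and>
    v \<notin> Domain triangle_arcs}"
  define P where "P = {{x, y} |x y. (x, y) \<in> parcs G - triangle_arcs \<and> x \<in> Domain triangle_arcs}"
  have "sym R" unfolding R_def by (rule symI) blast
  then show thesis
  proof (cases rule: alternating_coloring_or_odd_walk[where P = P])
    case (coloring c)
    show thesis
    proof (rule that[of c])
      show "c {v, a} \<noteq> c {v, b}"
        if "(v, a) \<in> parcs G" "(v, b) \<in> parcs G" "a \<noteq> b" "v \<notin> Domain triangle_arcs" for v a b
        by (rule coloring(1)) (use that in \<open>auto simp: R_def\<close>)
      show "c {x, y}" if "(x, y) \<in> parcs G - triangle_arcs" "x \<in> Domain triangle_arcs" for x y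
        by (rule coloring(2)) (use that in \<open>auto simp: P_def\<close>)
    qed
  next
    case (odd_walk n e)
    note odd = odd_walk(1) and walk = odd_walk(2) and dist = odd_walk(3) and ends = odd_walk(4)
    \<comment> \<open>\<open>J i v a b\<close> records the pivot \<open>v\<close> shared by the
      edges number \<open>i\<close> and \<open>Suc i\<close>, with their other ends \<open>a\<close>
      and \<open>b\<close>.\<close>
    define J where "J i v a b \<longleftrightarrow> e i = {v, a} \<and> e (Suc i) = {v, b} \<and>
      (v, a) \<in> parcs G \<and> (v, b) \<in> parcs G \<and> a \<noteq> b \<and> v \<notin> Domain triangle_arcs" for i v a b
    have "\<forall>i. \<exists>v a b. i < n \<longrightarrow> J i v a b"
      using walk unfolding R_def J_def by blast
    then obtain w a b where "i < n \<Longrightarrow> J i (w i) (a i) (b i)" for i by metis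
    then have w: "e i = {w i, a i}" "e (Suc i) = {w i, b i}"
      "(w i, a i) \<in> parcs G" "(w i, b i) \<in> parcs G" "a i \<noteq> b i" "w i \<notin> Domain triangle_arcs"
      if "i < n" for i
      using that unfolding J_def by blast+
    \<comment> \<open>A pivot has only two edges. Turning twice about it would return to the edge
      \<open>e i\<close>, which minimality allows only for \<open>n = 2\<close>, an even
      length.\<close>
    have w_Suc: "w i \<noteq> w (Suc i)" if i: "Suc i < n" for i
    proof
      assume eq: "w i = w (Suc i)"
      have "b i = a (Suc i)"
        using w(2)[of i] w(1)[of "Suc i"] i eq by (auto simp: doubleton_eq_iff)
      then have "b (Suc i) = a i"
        using at_most_two_nbrs[OF no_claw w(6,3,4)[of i], of "b (Suc i)"]
          w(4,5)[of "Suc i"] w(5)[of i] i eq by auto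
      then have "e i = e (Suc (Suc i))" using w(1)[of i] w(2)[of "Suc i"] i eq by auto
      then have "n = 2" using dist[of i "Suc (Suc i)"] i by auto
      then show False using odd by simp
    qed
    have e_Suc: "b i = w (Suc i)" if i: "Suc i < n" for i
      using w(2)[of i] w(1)[of "Suc i"] i w_Suc[OF i] by (auto simp: doubleton_eq_iff)
    \<comment> \<open>A repeated pivot would make \<open>e j\<close> one of the two edges already
      used at that pivot, while only the first and last edges of the walk may coincide.\<close>
    have w_ne: "w i \<noteq> w j" if ij: "i < j" "j < n" for i j
    proof
      assume eq: "w i = w j"
      have "j \<noteq> Suc i" using w_Suc[of i] eq ij by auto
      then have "Suc i < j" using ij by simp
      have "i < n" using ij by simp
      then have "a j = a i \<or> a j = b i"
        using at_most_two_nbrs[OF no_claw w(6,3,4)[of i], of "a j"] w(5)[of i] w(3)[OF ij(2)] eq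
        by auto
      moreover have "e j = {w i, a j}" using w(1)[OF ij(2)] eq by simp
      ultimately have "e j = e i \<or> e j = e (Suc i)"
        using w(1,2)[OF \<open>i < n\<close>] by metis
      then show False using dist[of i j] dist[of "Suc i" j] ij \<open>Suc i < j\<close> by auto
    qed
    then have w_inj: "inj_on w {..<n}" by (intro linorder_inj_onI) auto
    have w_arc: "(w i, w (Suc i)) \<in> parcs G" if "Suc i < n" for i
      using w(4)[of i] e_Suc[OF that] that by simp
    have "0 < n" using odd by (cases n) auto
    then obtain l where l: "n = Suc l" by (cases n) auto
    have e0: "e 0 = {w 0, a 0}" "(w 0, a 0) \<in> parcs G" using w[of 0] \<open>0 < n\<close> by auto
    have en: "e n = {w l, b l}" "(w l, b l) \<in> parcs G" using w[of l] l by auto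
    have False
    proof (cases "e 0 = e n")
      case True
      \<comment> \<open>Closed walk: the pivots form a cycle of odd length \<open>n\<close>. Length
        1 contradicts \<open>a 0 \<noteq> b 0\<close>, length 3 puts pivots on a triangle, and
        longer cycles are odd holes.\<close>
      have "n \<noteq> 1" using True w(1,2,5)[of 0] by (auto simp: doubleton_eq_iff)
      then have "3 \<le> n" using odd \<open>0 < n\<close> by (cases "n = 2") auto
      then have "w 0 \<noteq> w l" using w_ne[of 0 l] l by simp
      then have "a 0 = w l" using True e0 en by (auto simp: doubleton_eq_iff)
      then have closed: "(w 0, w (n - 1)) \<in> parcs G" using e0 l by simp
      show False
      proof (cases "n = 3")
        case True
        then have "(w 0, w 1) \<in> parcs G" "(w 1, w 2) \<in> parcs G" "(w 0, w 2) \<in> parcs G"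
          using w_arc[of 0] w_arc[of 1] closed by (simp_all add: numeral_2_eq_2)
        then show False using in_triangle_verts[of "w 0"] w(6)[of 0] \<open>0 < n\<close> by blast
      next
        case False
        have "contains_odd_hole G"
        proof (rule odd_hole_of_closed_path[of n w])
          fix i x assume i: "0 < i" "Suc i < n" and x: "(w i, x) \<in> parcs G"
          have "(w i, w (i - 1)) \<in> parcs G" using w_arc[of "i - 1"] i parcs_sym by simp
          moreover have "w (i - 1) \<noteq> w (Suc i)" using w_ne[of "i - 1" "Suc i"] i by simp
          ultimately show "x = w (i - 1) \<or> x = w (Suc i)"
            using at_most_two_nbrs[OF no_claw w(6) _ w_arc x] i by simp
        next
          show "4 < n" using \<open>3 \<le> n\<close> \<open>n \<noteq> 3\<close> odd by (cases "n = 4") auto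
        qed (use w_inj w_arc closed odd in auto)
        then show False using no_odd_hole by blast
      qed
    next
      case False
      then have pins: "e 0 \<in> P" "e n \<in> P" using ends by auto
      \<comment> \<open>Pivots lie on no triangle, so the two pinned edges meet triangles at their
        outer ends \<open>s\<close> and \<open>t\<close>.\<close>
      define s where "s = a 0"
      define t where "t = b l"
      have s: "s \<in> Domain triangle_arcs"
        using pins(1) e0 w(6)[OF \<open>0 < n\<close>] unfolding P_def s_def by (auto simp: doubleton_eq_iff)
      have t: "t \<in> Domain triangle_arcs"
        using pins(2) en w(6)[of l] l unfolding P_def t_def by (auto simp: doubleton_eq_iff)
      have sw: "(s, w 0) \<in> parcs G - triangle_arcs"
        using e0 w(6)[of 0] \<open>0 < n\<close> parcs_sym unfolding s_def by (intro nontriangle_arc) auto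
      have tw: "(t, w l) \<in> parcs G - triangle_arcs"
        using en w(6)[of l] l parcs_sym unfolding t_def by (intro nontriangle_arc) auto
      \<comment> \<open>Otherwise the unique non-triangle arc at this vertex would be both the first
        and the last edge.\<close>
      have "s \<noteq> t"
      proof
        assume "s = t"
        then have "w 0 = w l" using unique_nontriangle_arc[OF no_claw s sw] tw by simp
        then show False using False e0 en \<open>s = t\<close> unfolding s_def t_def by simp
      qed
      \<comment> \<open>The pivots with \<open>s\<close> in front and \<open>t\<close> behind:
        \<open>n + 2\<close> vertices, again an odd number.\<close>
      define u where "u i = (if i = 0 then s else if i \<le> n then w (i - 1) else t)" for i
      define m where "m = Suc (Suc n)"
      have u: "u 0 = s" "u (m - 1) = t" by (simp_all add: u_def m_def)
      have arc: "(u i, u (Suc i)) \<in> parcs G" if i: "Suc i < m" for i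
      proof -
        consider "i = 0" | i' where "i = Suc i'" "i < n" | "i = n" "0 < n"
          using i \<open>0 < n\<close> unfolding m_def by (cases i) force+
        then show ?thesis
        proof cases
          case 1
          then show ?thesis using sw \<open>0 < n\<close> by (simp add: u_def)
        next
          case 2
          then show ?thesis using w_arc[of i'] by (simp add: u_def)
        next
          case 3
          then show ?thesis using tw l parcs_sym by (simp add: u_def)
        qed
      qed
      have inj: "inj_on u {..<m}"
      proof (rule linorder_inj_onI)
        fix i j assume ij: "i < j" "i \<in> {..<m}" "j \<in> {..<m}"
        have u_w: "u j \<notin> Domain triangle_arcs" if "0 < j" "j \<le> n" for j
          using that w(6)[of "j - 1"] by (simp add: u_def)
        consider "i = 0" "j \<le> n" | "i = 0" "j = Suc n" | "0 < i" "j \<le> n" | "0 < i" "j = Suc n"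
          using ij unfolding m_def by force
        then show "u i \<noteq> u j"
        proof cases
          case 1
          then show ?thesis using u_w[of j] ij s by (auto simp: u_def)
        next
          case 2
          then show ?thesis using \<open>s \<noteq> t\<close> by (simp add: u_def)
        next
          case 3
          then show ?thesis using w_ne[of "i - 1" "j - 1"] ij by (simp add: u_def)
        next
          case 4
          then show ?thesis using u_w[of i] ij t by (auto simp: u_def)
        qed
      qed auto
      have inner: "x = u (i - 1) \<or> x = u (Suc i)"
        if i: "0 < i" "Suc i < m" and x: "(u i, x) \<in> parcs G" for i x
      proof -
        have "u i \<notin> Domain triangle_arcs" using i w(6)[of "i - 1"] by (simp add: u_def m_def)
        moreover have "(u i, u (i - 1)) \<in> parcs G" using arc[of "i - 1"] i parcs_sym by simp
        moreover have "u (i - 1) \<noteq> u (Suc i)"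
          using inj_onD[OF inj, of "i - 1" "Suc i"] i by (cases i) auto
        ultimately show ?thesis using at_most_two_nbrs[OF no_claw _ _ arc[OF i(2)] x] by blast
      qed
      have m: "odd m" "3 \<le> m" using odd \<open>0 < n\<close> by (auto simp: m_def)
      show False
      \<comment> \<open>If \<open>s\<close> and \<open>t\<close> are adjacent, the path closes to a
        triangle through a pivot for \<open>n = 1\<close> and to an odd hole otherwise; if not, it
        is a bad chain.\<close>
      proof (cases "(u 0, u (m - 1)) \<in> parcs G")
        case True
        have "n \<noteq> 1"
        proof
          assume "n = 1"
          then have "l = 0" using l by simp
          have "(w 0, s) \<in> parcs G" "(w 0, t) \<in> parcs G" "(s, t) \<in> parcs G"
            using e0 en True u \<open>l = 0\<close> unfolding s_def t_def by simp_all
          then show False using in_triangle_verts w(6)[OF \<open>0 < n\<close>] by blast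
        qed
        then have "4 < m" using odd \<open>0 < n\<close> unfolding m_def by (cases "n = 2") auto
        then have "contains_odd_hole G"
          using odd_hole_of_closed_path[OF inner inj arc True m(1)] by blast
        then show False using no_odd_hole by blast
      next
        case False
        have "bad_chain G (map u [0..<m])"
          using bad_chain_of_path[OF inner inj arc False m] deg_triangle_vertex[OF s sw]
            deg_triangle_vertex[OF t tw] unfolding u by blast
        then show False using no_bad_chain by blast
      qed
    qed
    then show thesis ..
  qed
qed

text \<open>The classes are generated by the triangle arcs and the edges coloured inner. Both
  relations fit together into an equivalence, since an inner edge outside the triangles touches no
  triangle vertex.\<close>

lemma exists_clique_partition:
  assumes no_claw: "\<not> contains_claw G" and no_odd_hole: "\<not> contains_odd_hole G"
    and no_bad_chain: "\<nexists>us. bad_chain G us"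
    and no_diamond: "\<not> contains_induced G diamond_graph"
    and no_butterfly: "\<not> contains_induced G butterfly_graph"
    and no_C4: "\<not> contains_induced G (cycle_graph 4)"
  obtains k where "clique_partition G k"
proof -
  obtain c where
    alt: "\<And>v a b. \<lbrakk>(v, a) \<in> parcs G; (v, b) \<in> parcs G; a \<noteq> b; v \<notin> Domain triangle_arcs\<rbrakk>
      \<Longrightarrow> c {v, a} \<noteq> c {v, b}"
    and pin: "\<And>x y. \<lbrakk>(x, y) \<in> parcs G - triangle_arcs; x \<in> Domain triangle_arcs\<rbrakk> \<Longrightarrow> c {x, y}"
    using cross_coloring[OF no_claw no_odd_hole no_bad_chain] by blast
  define S where "S = {(x, y). x = y \<or> (x, y) \<in> triangle_arcs \<or>
    (x, y) \<in> parcs G - triangle_arcs \<and> \<not> c {x, y}}"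
  have S_sym: "(y, x) \<in> S" if "(x, y) \<in> S" for x y
    using that parcs_sym[of x y] triangle_arcs_sym[of x y] by (auto simp: S_def insert_commute)
  have S_trans: "(x, z) \<in> S" if xy: "(x, y) \<in> S" and yz: "(y, z) \<in> S" for x y z
  proof (cases "x = y \<or> y = z \<or> x = z")
    case True
    then show ?thesis using xy yz by (auto simp: S_def)
  next
    case False
    have "(y, x) \<in> S" using xy by (rule S_sym)
    show ?thesis
    \<comment> \<open>If \<open>y\<close> lies on a triangle, its non-triangle edges are crossing,
      so both arcs are triangle arcs. Otherwise alternation forbids two inner edges at
      \<open>y\<close>.\<close>
    proof (cases "(y, x) \<in> triangle_arcs \<or> (y, z) \<in> triangle_arcs")
      case True
      then have "y \<in> Domain triangle_arcs" by blast
      then have "(y, x) \<in> triangle_arcs" "(y, z) \<in> triangle_arcs"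
        using pin \<open>(y, x) \<in> S\<close> yz False unfolding S_def by blast+
      then have "(x, z) \<in> triangle_arcs"
        using triangle_arcs_trans[OF no_diamond no_butterfly] triangle_arcs_sym[of x y] False
        by blast
      then show ?thesis by (simp add: S_def)
    next
      case nontriangle: False
      then have arcs: "(y, x) \<in> parcs G - triangle_arcs" "(y, z) \<in> parcs G - triangle_arcs"
        and c: "\<not> c {y, x}" "\<not> c {y, z}"
        using \<open>(y, x) \<in> S\<close> yz False by (auto simp: S_def)
      then have "y \<notin> Domain triangle_arcs" using pin by blast
      then show ?thesis using alt[of y x z] arcs c False by blast
    qed
  qed
  have fin: "finite ((\<lambda>x. S `` {x}) ` pverts G)" by simp
  \<comment> \<open>Numbering the finitely many classes turns the equivalence into a labelling by
    naturals.\<close>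
  obtain enc :: "'a set \<Rightarrow> nat" where enc: "inj_on enc ((\<lambda>x. S `` {x}) ` pverts G)"
    using finite_imp_inj_to_nat_seg[OF fin] by metis
  define k where "k x = enc (S `` {x})" for x
  have k: "k x = k y \<longleftrightarrow> (x, y) \<in> S" if "x \<in> pverts G" "y \<in> pverts G" for x y
  proof -
    have "k x = k y \<longleftrightarrow> S `` {x} = S `` {y}"
      using inj_on_eq_iff[OF enc] that unfolding k_def by simp
    also have "\<dots> \<longleftrightarrow> (x, y) \<in> S"
    proof
      assume eq: "S `` {x} = S `` {y}"
      have "y \<in> S `` {y}" by (simp add: S_def)
      then have "y \<in> S `` {x}" unfolding eq .
      then show "(x, y) \<in> S" by simp
    next
      assume "(x, y) \<in> S"
      then show "S `` {x} = S `` {y}" using S_sym S_trans by blast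
    qed
    finally show ?thesis .
  qed
  have cross: "(x, y) \<in> parcs G - triangle_arcs \<and> c {x, y}"
    if "(x, y) \<in> parcs G" "k x \<noteq> k y" for x y
  proof -
    have "(x, y) \<notin> S" using k that wellformed' by blast
    then show ?thesis using that by (auto simp: S_def)
  qed
  have match: "y = z" if "(x, y) \<in> parcs G" "(x, z) \<in> parcs G" "k x \<noteq> k y" "k x \<noteq> k z" for x y z
  proof (cases "x \<in> Domain triangle_arcs")
    case True
    then show ?thesis using unique_nontriangle_arc[OF no_claw] cross that by blast
  next
    case False
    then show ?thesis using alt[of x y z] cross[of x y] cross[of x z] that by blast
  qed
  have "clique_partition G k" unfolding clique_partition_def
  proof (intro conjI ballI allI impI)
    fix x y assume "x \<in> pverts G" "y \<in> pverts G" "k x = k y" "x \<noteq> y"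
    then show "(x, y) \<in> parcs G" using k triangle_arcsD by (auto simp: S_def)
  next
    fix x y z assume "(x, y) \<in> parcs G" "(x, z) \<in> parcs G" "k x \<noteq> k y" "k x \<noteq> k z"
    then show "y = z" by (rule match)
  next
    fix x y x' y'
    assume *: "(x, y) \<in> parcs G" "(x', y') \<in> parcs G" "k x = k x'" "k y = k y'" "k x \<noteq> k y"
    have sym: "(y, x) \<in> parcs G" "(y', x') \<in> parcs G" using * parcs_sym by blast+
    show "x = x'"
    proof (rule ccontr)
      assume "x \<noteq> x'"
      then have "y \<noteq> y'" using match[of y x x'] * sym by auto
      \<comment> \<open>Two crossing edges between the same classes close up to the cycle
        \<open>x y y' x'\<close>. A chord would be a second crossing edge at \<open>x\<close> or
        \<open>y\<close>, so the cycle is induced.\<close>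
      have "(x', x) \<in> S" "(y, y') \<in> S" using k * wellformed' by metis+
      then have "(x', x) \<in> parcs G" "(y, y') \<in> parcs G"
        using \<open>x \<noteq> x'\<close> \<open>y \<noteq> y'\<close> triangle_arcsD by (auto simp: S_def)
      moreover have "(x, y') \<notin> parcs G" using match[of x y y'] * \<open>y \<noteq> y'\<close> by auto
      moreover have "(y, x') \<notin> parcs G" using match[of y x x'] * sym \<open>x \<noteq> x'\<close> by auto
      moreover have ne: "x \<noteq> y'" "y \<noteq> x'" using * by auto
      ultimately have "contains_induced G (cycle_graph 4)"
        unfolding contains_C4_iff[OF pair_graph_axioms] using *(1) sym(2) ne
        by - (rule exI[of _ x], rule exI[of _ y], rule exI[of _ y'], rule exI[of _ x'], simp)
      then show False using no_C4 by blast
    qed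
  qed
  then show thesis by (rule that)
qed

end

theorem corollary2p8:
  fixes F :: "'a pair_pre_digraph"
  assumes "pair_graph F"
  shows "expanded_clique_graph F \<longleftrightarrow>
           \<not> (\<exists>us. bad_chain F us) \<and>
           \<not> contains_induced F butterfly_graph \<and>
           \<not> contains_claw F \<and>
           \<not> contains_induced F (cycle_graph 4) \<and>
           \<not> contains_induced F diamond_graph \<and>
           \<not> contains_odd_hole F" (is "?E \<longleftrightarrow> ?N")
proof
  interpret pair_graph F by fact
  assume ?E
  then obtain k where "clique_partition F k"
    by (rule expanded_clique_graph_imp_clique_partition)
  then show ?N
    using no_bad_chain_of_partition no_butterfly_of_partition no_claw_of_partition
      no_C4_of_partition no_diamond_of_partition no_odd_hole_of_partition by blast
next
  interpret pair_graph F by fact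
  assume ?N
  then obtain k where "clique_partition F k" using exists_clique_partition by blast
  then show ?E by (rule clique_partition_imp_expanded_clique_graph[OF assms])
qed

end
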